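(* Let a quaternionic Kähler manifold with Hermitian-Norden metrics $(M,H,G)$ be in some of the classes $\mathcal W_1\oplus\mathcal W_2$ (and in particular $\mathcal W_0$, $\mathcal W_1$ and $\mathcal W_2$), $\mathcal W_2\oplus\mathcal W_3$ and $\mathcal W_3$ with respect to both of the structures $J_2$ and $J_3$. Then $(M,H,G)$ is a flat hyper-Kähler manifold with Hermitian-Norden metrics. The unique class (except the class without conditions for $DJ_2$ and $DJ_3$), where $(M,H,G)$ is not flat hyper-Kählerian, is $\mathcal W_1\oplus\mathcal W_3$ and its manifolds are determined by $$(D_xJ_1)y=0,$$ $$(D_xJ_2)y=\omega_1(x)J_3y,\qquad \omega_1(x)=-\theta_2(J_3x),$$ $$(D_xJ_3)y=-\omega_1(x)J_2y,\qquad \omega_1(x)=\theta_3(J_2x).$$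
   Context: An almost hypercomplex manifold $(M,H)$ is a $4n$-dimensional differentiable manifold with a triad $H=(J_1,J_2,J_3)$ of almost complex structures such that $J_\alpha=J_\beta\circ J_\gamma=-J_\gamma\circ J_\beta$, $J_\alpha^2=-I$ for all cyclic permutations $(\alpha,\beta,\gamma)$ of $(1,2,3)$. Hermitian-Norden metrics $G=(g,\tilde g_1,\tilde g_2,\tilde g_3)$ are given by a pseudo-Riemannian metric $g$ of neutral signature with $g(x,y)=\varepsilon_\alpha g(J_\alpha x,J_\alpha y)$, where $\varepsilon_1=1$, $\varepsilon_2=\varepsilon_3=-1$, together with $\tilde g_\alpha(x,y)=g(J_\alpha x,y)$. Let $D$ be the Levi-Civita connection of $g$. The manifold $(M,H,G)$ is quaternionic Kähler if there are local 1-forms $\omega_1,\omega_2,\omega_3$ associated to $H$ with $(D_xJ_\alpha)y=\omega_\gamma(x)J_\beta y-\omega_\beta(x)J_\gamma y$ for all cyclic permutations $(\alpha,\beta,\gamma)$ of $(1,2,3)$. It is a hyper-Kähler manifold with Hermitian-Norden metrics if $DJ_\alpha=0$ for $\alpha=1,2,3$. Flat means that the curvature tensor of $D$ vanishes. Put $F_\alpha(x,y,z)=g((D_xJ_\alpha)y,z)$ and let $\theta_\alpha(z)=g^{ij}F_\alpha(e_i,e_j,z)$ be the Lee forms, where $\{e_i\}$ is an arbitrary basis of the tangent space and $(g^{ij})$ is the inverse matrix of $g$; $\mathfrak S$ denotes the cyclic sum over $x,y,z$. For $\alpha=2,3$ the classes of $(M,J_\alpha,g)$ with respect to $J_\alpha$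 are: $\mathcal W_0$: $F_\alpha=0$; $\mathcal W_1$: $F_\alpha(x,y,z)=\frac1{4n}\{g(x,y)\theta_\alpha(z)+g(x,z)\theta_\alpha(y)+g(x,J_\alpha y)\theta_\alpha(J_\alpha z)+g(x,J_\alpha z)\theta_\alpha(J_\alpha y)\}$; $\mathcal W_2$: $\mathfrak S F_\alpha(x,y,J_\alpha z)=0$, $\theta_\alpha=0$; $\mathcal W_3$: $\mathfrak S F_\alpha(x,y,z)=0$; $\mathcal W_1\oplus\mathcal W_2$: $\mathfrak S F_\alpha(x,y,J_\alpha z)=0$; $\mathcal W_2\oplus\mathcal W_3$: $\theta_\alpha=0$; $\mathcal W_1\oplus\mathcal W_3$: $\mathfrak S F_\alpha(x,y,z)=\frac1{2n}\mathfrak S\{g(x,y)\theta_\alpha(z)+g(J_\alpha x,y)\theta_\alpha(J_\alpha z)\}$; $\mathcal W_1\oplus\mathcal W_2\oplus\mathcal W_3$: no conditions. Membership of $(M,H,G)$ in a class is understood with respect to both $J_2$ and $J_3$.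
   Formalization: Existence of non-flat manifolds in W1⊕W3 is not claimed (contracting the class condition gives ω_1=0): W1⊕W3 is only the sole possible exception, and "determined by" means that within W1⊕W3 being quaternionic Kähler is equivalent to the displayed equations. *)

theory Defs
  imports "HOL-Analysis.Analysis"
begin

section \<open>Smooth manifolds\<close>

text \<open>Iterated directional derivatives; used on open sets, where it is the usual notion of a
  function of class \<open>C\<^sup>k\<close>.\<close>

primrec Ck_on :: "nat \<Rightarrow> ('v::real_normed_vector \<Rightarrow> 'b::real_normed_vector) \<Rightarrow> 'v set \<Rightarrow> bool" where
  "Ck_on 0 f S \<longleftrightarrow> continuous_on S f"
| "Ck_on (Suc k) f S \<longleftrightarrow>
     (\<forall>x\<in>S. f differentiable (at x)) \<and> (\<forall>v. Ck_on k (\<lambda>x. frechet_derivative f (at x) v) S)"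

definition smooth_on :: "'v set \<Rightarrow> ('v::real_normed_vector \<Rightarrow> 'b::real_normed_vector) \<Rightarrow> bool" where
  "smooth_on S f \<longleftrightarrow> (\<forall>k. Ck_on k f S)"

text \<open>A chart consists of its domain and its coordinate map (irrelevant outside the domain).\<close>

type_synonym ('a, 'm) chart = "'a set \<times> ('a \<Rightarrow> real^'m)"

definition coord_image :: "('a, 'm::finite) chart \<Rightarrow> 'a set \<Rightarrow> (real^'m) set" where
  "coord_image c W = snd c ` (fst c \<inter> W)"

definition transition :: "('a, 'm::finite) chart \<Rightarrow> ('a, 'm) chart \<Rightarrow> real^'m \<Rightarrow> real^'m" where
  "transition c c' = snd c' \<circ> inv_into (fst c) (snd c)"

definition smooth_manifold :: "'a topology \<Rightarrow> ('a, 'm::finite) chart set \<Rightarrow> bool" where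
  "smooth_manifold X A \<longleftrightarrow>
     Hausdorff_space X \<and> second_countable X \<and>
     (\<Union>c\<in>A. fst c) = topspace X \<and>
     (\<forall>c\<in>A. openin X (fst c) \<and> open (snd c ` fst c) \<and>
        homeomorphic_map (subtopology X (fst c)) (top_of_set (snd c ` fst c)) (snd c)) \<and>
     (\<forall>c\<in>A. \<forall>c'\<in>A. smooth_on (coord_image c (fst c')) (transition c c'))"


section \<open>Tensor fields and connections\<close>

text \<open>
  Tensor fields are given by their local expressions: for every chart \<open>c\<close> of the atlas and every
  point \<open>x\<close> of its coordinate image, a multilinear map on the model space \<open>real^'m\<close>, which
  represents the tangent space at the corresponding point through the coordinate frame of \<open>c\<close>.
  On overlaps the local expressions are related by the differential of the transition map.
\<close>

type_synonym ('a, 'm) oneform = "('a, 'm) chart \<Rightarrow> real^'m \<Rightarrow> real^'m \<Rightarrow> real"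
type_synonym ('a, 'm) bilin_field = "('a, 'm) chart \<Rightarrow> real^'m \<Rightarrow> real^'m \<Rightarrow> real^'m \<Rightarrow> real"
type_synonym ('a, 'm) endo_field = "('a, 'm) chart \<Rightarrow> real^'m \<Rightarrow> real^'m \<Rightarrow> real^'m"
type_synonym ('a, 'm) conn = "('a, 'm) chart \<Rightarrow> real^'m \<Rightarrow> real^'m \<Rightarrow> real^'m \<Rightarrow> real^'m"

definition dtrans :: "('a, 'm::finite) chart \<Rightarrow> ('a, 'm) chart \<Rightarrow> real^'m \<Rightarrow> real^'m \<Rightarrow> real^'m" where
  "dtrans c c' x = frechet_derivative (transition c c') (at x)"

definition oneform_on :: "('a, 'm::finite) chart set \<Rightarrow> 'a set \<Rightarrow> ('a, 'm) oneform \<Rightarrow> bool" where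
  "oneform_on A W \<omega> \<longleftrightarrow>
     (\<forall>c\<in>A. (\<forall>x\<in>coord_image c W. linear (\<omega> c x)) \<and>
             (\<forall>v. smooth_on (coord_image c W) (\<lambda>x. \<omega> c x v))) \<and>
     (\<forall>c\<in>A. \<forall>c'\<in>A. \<forall>x\<in>coord_image c (fst c' \<inter> W). \<forall>v.
        \<omega> c' (transition c c' x) (dtrans c c' x v) = \<omega> c x v)"

definition bilin_field :: "('a, 'm::finite) chart set \<Rightarrow> ('a, 'm) bilin_field \<Rightarrow> bool" where
  "bilin_field A g \<longleftrightarrow>
     (\<forall>c\<in>A. (\<forall>x\<in>coord_image c UNIV. bilinear (g c x)) \<and>
             (\<forall>v w. smooth_on (coord_image c UNIV) (\<lambda>x. g c x v w))) \<and>
     (\<forall>c\<in>A. \<forall>c'\<in>A. \<forall>x\<in>coord_image c (fst c'). \<forall>v w.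
        g c' (transition c c' x) (dtrans c c' x v) (dtrans c c' x w) = g c x v w)"

definition endo_field :: "('a, 'm::finite) chart set \<Rightarrow> ('a, 'm) endo_field \<Rightarrow> bool" where
  "endo_field A J \<longleftrightarrow>
     (\<forall>c\<in>A. (\<forall>x\<in>coord_image c UNIV. linear (J c x)) \<and>
             (\<forall>v. smooth_on (coord_image c UNIV) (\<lambda>x. J c x v))) \<and>
     (\<forall>c\<in>A. \<forall>c'\<in>A. \<forall>x\<in>coord_image c (fst c'). \<forall>v.
        J c' (transition c c' x) (dtrans c c' x v) = dtrans c c' x (J c x v))"

text \<open>
  A linear connection \<open>D\<close> is given by its connection coefficients: \<open>\<Gamma> c x u v\<close> is the value at
  \<open>x\<close> of the covariant derivative, in the direction \<open>u\<close>, of the vector field with constant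
  components \<open>v\<close> in the chart \<open>c\<close>. The second derivative of the transition map accounts for the
  inhomogeneous term in the transformation law of Christoffel symbols.
\<close>

definition connection :: "('a, 'm::finite) chart set \<Rightarrow> ('a, 'm) conn \<Rightarrow> bool" where
  "connection A \<Gamma> \<longleftrightarrow>
     (\<forall>c\<in>A. (\<forall>x\<in>coord_image c UNIV. bilinear (\<Gamma> c x)) \<and>
             (\<forall>v w. smooth_on (coord_image c UNIV) (\<lambda>x. \<Gamma> c x v w))) \<and>
     (\<forall>c\<in>A. \<forall>c'\<in>A. \<forall>x\<in>coord_image c (fst c'). \<forall>v w.
        dtrans c c' x (\<Gamma> c x v w) =
          frechet_derivative (\<lambda>y. dtrans c c' y w) (at x) v +
          \<Gamma> c' (transition c c' x) (dtrans c c' x v) (dtrans c c' x w))"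

text \<open>\<open>D\<^sub>u Y\<close> at \<open>x\<close>, for a vector field with components \<open>Y\<close> in the chart \<open>c\<close>.\<close>

definition cov :: "('a, 'm::finite) conn \<Rightarrow> ('a, 'm) chart \<Rightarrow> real^'m \<Rightarrow> real^'m
    \<Rightarrow> (real^'m \<Rightarrow> real^'m) \<Rightarrow> real^'m" where
  "cov \<Gamma> c x u Y = frechet_derivative Y (at x) u + \<Gamma> c x u (Y x)"

text \<open>
  In the following definitions tangent vectors are extended by vector fields with constant
  components in the chart \<open>c\<close>. Their Lie brackets vanish, so no bracket terms occur in the
  torsion and in the curvature.
\<close>

definition cov_endo :: "('a, 'm::finite) conn \<Rightarrow> ('a, 'm) endo_field \<Rightarrow> ('a, 'm) chart
    \<Rightarrow> real^'m \<Rightarrow> real^'m \<Rightarrow> real^'m \<Rightarrow> real^'m" where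
  "cov_endo \<Gamma> J c x u v = cov \<Gamma> c x u (\<lambda>y. J c y v) - J c x (cov \<Gamma> c x u (\<lambda>_. v))"

definition curvature :: "('a, 'm::finite) conn \<Rightarrow> ('a, 'm) chart
    \<Rightarrow> real^'m \<Rightarrow> real^'m \<Rightarrow> real^'m \<Rightarrow> real^'m \<Rightarrow> real^'m" where
  "curvature \<Gamma> c x u v w =
     cov \<Gamma> c x u (\<lambda>y. cov \<Gamma> c y v (\<lambda>_. w)) - cov \<Gamma> c x v (\<lambda>y. cov \<Gamma> c y u (\<lambda>_. w))"

definition levi_civita :: "('a, 'm::finite) chart set \<Rightarrow> ('a, 'm) bilin_field \<Rightarrow> ('a, 'm) conn \<Rightarrow> bool" where
  "levi_civita A g \<Gamma> \<longleftrightarrow>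
     connection A \<Gamma> \<and>
     (\<forall>c\<in>A. \<forall>x\<in>coord_image c UNIV. \<forall>u v w.
        cov \<Gamma> c x u (\<lambda>_. v) = cov \<Gamma> c x v (\<lambda>_. u) \<and>
        frechet_derivative (\<lambda>y. g c y v w) (at x) u =
          g c x (cov \<Gamma> c x u (\<lambda>_. v)) w + g c x v (cov \<Gamma> c x u (\<lambda>_. w)))"


section \<open>Almost hypercomplex manifolds with Hermitian-Norden metrics\<close>

definition neutral :: "nat \<Rightarrow> (real^'m::finite \<Rightarrow> real^'m \<Rightarrow> real) \<Rightarrow> bool" where
  "neutral k h \<longleftrightarrow>
     (\<exists>P N. subspace P \<and> subspace N \<and> dim P = k \<and> dim N = k \<and>
        (\<forall>v\<in>P - {0}. h v v > 0) \<and> (\<forall>v\<in>N - {0}. h v v < 0))"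

definition neutral_metric :: "nat \<Rightarrow> ('a, 'm::finite) chart set \<Rightarrow> ('a, 'm) bilin_field \<Rightarrow> bool" where
  "neutral_metric k A g \<longleftrightarrow>
     bilin_field A g \<and>
     (\<forall>c\<in>A. \<forall>x\<in>coord_image c UNIV.
        (\<forall>v w. g c x v w = g c x w v) \<and>
        (\<forall>v. (\<forall>w. g c x v w = 0) \<longrightarrow> v = 0) \<and>
        neutral k (g c x))"

definition cyclic123 :: "(nat \<times> nat \<times> nat) set" where
  "cyclic123 = {(1, 2, 3), (2, 3, 1), (3, 1, 2)}"

definition almost_hypercomplex :: "('a, 'm::finite) chart set \<Rightarrow> (nat \<Rightarrow> ('a, 'm) endo_field) \<Rightarrow> bool" where
  "almost_hypercomplex A J \<longleftrightarrow>
     (\<forall>a\<in>{1, 2, 3}. endo_field A (J a)) \<and>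
     (\<forall>(a, b, d)\<in>cyclic123. \<forall>c\<in>A. \<forall>x\<in>coord_image c UNIV. \<forall>v.
        J a c x v = J b c x (J d c x v) \<and>
        J a c x v = - J d c x (J b c x v) \<and>
        J a c x (J a c x v) = - v)"

definition hn_sign :: "nat \<Rightarrow> real" where
  "hn_sign a = (if a = 1 then 1 else -1)"

text \<open>
  The remaining metrics of the quadruple \<open>G\<close> are \<open>g (J a v) w\<close> for \<open>a = 1, 2, 3\<close>. They are
  determined by \<open>g\<close> and \<open>J\<close>, and so they are not separate data.
\<close>

definition hermitian_norden_manifold :: "nat \<Rightarrow> 'a topology \<Rightarrow> ('a, 'm::finite) chart set
    \<Rightarrow> (nat \<Rightarrow> ('a, 'm) endo_field) \<Rightarrow> ('a, 'm) bilin_field \<Rightarrow> bool" where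
  "hermitian_norden_manifold n X A J g \<longleftrightarrow>
     CARD('m) = 4 * n \<and> smooth_manifold X A \<and> almost_hypercomplex A J \<and>
     neutral_metric (2 * n) A g \<and>
     (\<forall>a\<in>{1, 2, 3}. \<forall>c\<in>A. \<forall>x\<in>coord_image c UNIV. \<forall>v w.
        g c x v w = hn_sign a * g c x (J a c x v) (J a c x w))"

definition quaternionic_kaehler :: "'a topology \<Rightarrow> ('a, 'm::finite) chart set
    \<Rightarrow> (nat \<Rightarrow> ('a, 'm) endo_field) \<Rightarrow> ('a, 'm) conn \<Rightarrow> bool" where
  "quaternionic_kaehler X A J \<Gamma> \<longleftrightarrow>
     (\<forall>p\<in>topspace X. \<exists>W \<omega>. openin X W \<and> p \<in> W \<and> (\<forall>a\<in>{1, 2, 3}. oneform_on A W (\<omega> a)) \<and>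
        (\<forall>(a, b, d)\<in>cyclic123. \<forall>c\<in>A. \<forall>x\<in>coord_image c W. \<forall>u v.
           cov_endo \<Gamma> (J a) c x u v =
             \<omega> d c x u *\<^sub>R J b c x v - \<omega> b c x u *\<^sub>R J d c x v))"

definition hyper_kaehler :: "('a, 'm::finite) chart set
    \<Rightarrow> (nat \<Rightarrow> ('a, 'm) endo_field) \<Rightarrow> ('a, 'm) conn \<Rightarrow> bool" where
  "hyper_kaehler A J \<Gamma> \<longleftrightarrow>
     (\<forall>a\<in>{1, 2, 3}. \<forall>c\<in>A. \<forall>x\<in>coord_image c UNIV. \<forall>u v. cov_endo \<Gamma> (J a) c x u v = 0)"

definition flat :: "('a, 'm::finite) chart set \<Rightarrow> ('a, 'm) conn \<Rightarrow> bool" where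
  "flat A \<Gamma> \<longleftrightarrow> (\<forall>c\<in>A. \<forall>x\<in>coord_image c UNIV. \<forall>u v w. curvature \<Gamma> c x u v w = 0)"


section \<open>Fundamental tensors, Lee forms and classes\<close>

definition fund :: "(nat \<Rightarrow> ('a, 'm::finite) endo_field) \<Rightarrow> ('a, 'm) bilin_field \<Rightarrow> ('a, 'm) conn
    \<Rightarrow> nat \<Rightarrow> ('a, 'm) chart \<Rightarrow> real^'m \<Rightarrow> real^'m \<Rightarrow> real^'m \<Rightarrow> real^'m \<Rightarrow> real" where
  "fund J g \<Gamma> a c x u v w = g c x (cov_endo \<Gamma> (J a) c x u v) w"

definition metric_trace :: "('m \<Rightarrow> real^'m) \<Rightarrow> (real^'m::finite \<Rightarrow> real^'m \<Rightarrow> real)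
    \<Rightarrow> (real^'m \<Rightarrow> real^'m \<Rightarrow> real) \<Rightarrow> real" where
  "metric_trace e h F =
     (\<Sum>i\<in>UNIV. \<Sum>j\<in>UNIV. matrix_inv (\<chi> i j. h (e i) (e j)) $ i $ j * F (e i) (e j))"

text \<open>The basis is the coordinate basis; \<open>metric_trace_basis\<close> below shows that any basis of the
  tangent space gives the same value.\<close>

definition lee :: "(nat \<Rightarrow> ('a, 'm::finite) endo_field) \<Rightarrow> ('a, 'm) bilin_field \<Rightarrow> ('a, 'm) conn
    \<Rightarrow> nat \<Rightarrow> ('a, 'm) chart \<Rightarrow> real^'m \<Rightarrow> real^'m \<Rightarrow> real" where
  "lee J g \<Gamma> a c x w =
     metric_trace (\<lambda>i. axis i 1) (g c x) (\<lambda>u v. fund J g \<Gamma> a c x u v w)"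

definition cyc :: "('v \<Rightarrow> 'v \<Rightarrow> 'v \<Rightarrow> real) \<Rightarrow> 'v \<Rightarrow> 'v \<Rightarrow> 'v \<Rightarrow> real" where
  "cyc T x y z = T x y z + T y z x + T z x y"

text \<open>\<open>W12\<close> stands for the direct sum of the classes \<open>W1\<close> and \<open>W2\<close>, and so on.\<close>

datatype hn_class = W0 | W1 | W2 | W3 | W12 | W13 | W23 | W123

fun class_cond :: "hn_class \<Rightarrow> nat \<Rightarrow> ('v \<Rightarrow> 'v \<Rightarrow> real) \<Rightarrow> ('v \<Rightarrow> 'v)
    \<Rightarrow> ('v \<Rightarrow> 'v \<Rightarrow> 'v \<Rightarrow> real) \<Rightarrow> ('v \<Rightarrow> real) \<Rightarrow> bool" where
  "class_cond W0 n g J F \<theta> \<longleftrightarrow> (\<forall>x y z. F x y z = 0)"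
| "class_cond W1 n g J F \<theta> \<longleftrightarrow> (\<forall>x y z. F x y z = 1 / (4 * real n) *
     (g x y * \<theta> z + g x z * \<theta> y + g x (J y) * \<theta> (J z) + g x (J z) * \<theta> (J y)))"
| "class_cond W2 n g J F \<theta> \<longleftrightarrow>
     (\<forall>x y z. cyc (\<lambda>x y z. F x y (J z)) x y z = 0) \<and> (\<forall>z. \<theta> z = 0)"
| "class_cond W3 n g J F \<theta> \<longleftrightarrow> (\<forall>x y z. cyc F x y z = 0)"
| "class_cond W12 n g J F \<theta> \<longleftrightarrow> (\<forall>x y z. cyc (\<lambda>x y z. F x y (J z)) x y z = 0)"
| "class_cond W13 n g J F \<theta> \<longleftrightarrow> (\<forall>x y z. cyc F x y z = 1 / (2 * real n) *
     cyc (\<lambda>x y z. g x y * \<theta> z + g (J x) y * \<theta> (J z)) x y z)"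
| "class_cond W23 n g J F \<theta> \<longleftrightarrow> (\<forall>z. \<theta> z = 0)"
| "class_cond W123 n g J F \<theta> \<longleftrightarrow> True"

definition in_class :: "hn_class \<Rightarrow> nat \<Rightarrow> ('a, 'm::finite) chart set
    \<Rightarrow> (nat \<Rightarrow> ('a, 'm) endo_field) \<Rightarrow> ('a, 'm) bilin_field \<Rightarrow> ('a, 'm) conn \<Rightarrow> bool" where
  "in_class C n A J g \<Gamma> \<longleftrightarrow>
     (\<forall>a\<in>{2, 3}. \<forall>c\<in>A. \<forall>x\<in>coord_image c UNIV.
        class_cond C n (g c x) (J a c x) (fund J g \<Gamma> a c x) (lee J g \<Gamma> a c x))"

lemma bilinear_matrix:
  fixes h :: "real^'m::finite \<Rightarrow> real^'m \<Rightarrow> real"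
  assumes "bilinear h"
  shows "h u v = u \<bullet> ((\<chi> i j. h (axis i 1) (axis j 1)) *v v)"
proof -
  have l: "linear (\<lambda>x. h x y)" "linear (h x)" for x y
    using assms by (auto simp: bilinear_def)
  have expand: "x = (\<Sum>i\<in>UNIV. x $ i *\<^sub>R axis i 1)" for x :: "real^'m"
    using basis_expansion[of x] by (simp add: scalar_mult_eq_scaleR)
  have "h u v = (\<Sum>i\<in>UNIV. u $ i * h (axis i 1) v)"
    by (subst expand[of u]) (simp add: linear_sum[OF l(1)] linear_cmul[OF l(1)])
  also have "\<dots> = (\<Sum>i\<in>UNIV. u $ i * (\<Sum>j\<in>UNIV. v $ j * h (axis i 1) (axis j 1)))"
  proof (intro sum.cong refl arg_cong2[where f = "(*)"])
    show "h (axis i 1) v = (\<Sum>j\<in>UNIV. v $ j * h (axis i 1) (axis j 1))" for i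
      by (subst expand[of v]) (simp add: linear_sum[OF l(2)] linear_cmul[OF l(2)])
  qed
  finally show ?thesis
    by (simp add: inner_vec_def matrix_vector_mult_def mult.commute[of "v $ _"])
qed

lemma gram_basis_change:
  fixes h :: "real^'m::finite \<Rightarrow> real^'m \<Rightarrow> real" and e :: "'m \<Rightarrow> real^'m"
  assumes "bilinear h"
  defines "E \<equiv> \<chi> i j. e j $ i"
  shows "(\<chi> i j. h (e i) (e j)) =
    transpose E ** (\<chi> i j. h (axis i 1) (axis j 1)) ** E"
proof -
  define G :: "real^'m^'m" where "G = (\<chi> i j. h (axis i 1) (axis j 1))"
  have "h (e i) (e j) = (transpose E ** G ** E) $ i $ j" for i j
  proof -
    have "h (e i) (e j) = (\<Sum>k\<in>UNIV. \<Sum>l\<in>UNIV. e i $ k * (G $ k $ l * e j $ l))"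
      by (subst bilinear_matrix[OF assms(1)])
        (simp add: G_def inner_vec_def matrix_vector_mult_def sum_distrib_left)
    also have "\<dots> = (\<Sum>l\<in>UNIV. \<Sum>k\<in>UNIV. e i $ k * (G $ k $ l * e j $ l))"
      by (rule sum.swap)
    also have "\<dots> = (transpose E ** G ** E) $ i $ j"
      by (simp add: E_def matrix_matrix_mult_def transpose_def sum_distrib_right mult.assoc)
    finally show ?thesis .
  qed
  then show ?thesis by (simp add: vec_eq_iff G_def)
qed

lemma matrix_inv_mat1:
  fixes M :: "real^'m::finite^'m"
  assumes "invertible M"
  shows "M ** matrix_inv M = mat 1" "matrix_inv M ** M = mat 1"
  using someI_ex[OF assms[unfolded invertible_def]] by (auto simp: matrix_inv_def)

lemma matrix_inv_eqI:
  fixes M N :: "real^'m::finite^'m"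
  assumes "M ** N = mat 1" "N ** M = mat 1"
  shows "matrix_inv M = N"
proof -
  have "invertible M" using assms by (auto simp: invertible_def)
  then have "matrix_inv M ** (M ** N) = N"
    by (simp add: matrix_mul_assoc matrix_inv_mat1)
  then show ?thesis by (simp add: assms)
qed

lemma matrix_inv_mult:
  fixes M N :: "real^'m::finite^'m"
  assumes "invertible M" "invertible N"
  shows "matrix_inv (M ** N) = matrix_inv N ** matrix_inv M"
proof (rule matrix_inv_eqI)
  have "M ** N ** (matrix_inv N ** matrix_inv M) = M ** (N ** matrix_inv N) ** matrix_inv M"
    by (simp add: matrix_mul_assoc)
  then show "M ** N ** (matrix_inv N ** matrix_inv M) = mat 1"
    using assms by (simp add: matrix_inv_mat1)
  have "matrix_inv N ** matrix_inv M ** (M ** N) = matrix_inv N ** (matrix_inv M ** M) ** N"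
    by (simp add: matrix_mul_assoc)
  then show "matrix_inv N ** matrix_inv M ** (M ** N) = mat 1"
    using assms by (simp add: matrix_inv_mat1)
qed

lemma metric_trace_eq_trace:
  "metric_trace e h F = trace (matrix_inv (\<chi> i j. h (e i) (e j)) ** transpose (\<chi> i j. F (e i) (e j)))"
  by (simp add: metric_trace_def trace_def matrix_matrix_mult_def transpose_def)

lemma metric_trace_basis:
  fixes h F :: "real^'m::finite \<Rightarrow> real^'m \<Rightarrow> real"
  assumes h: "bilinear h" and nondeg: "\<And>v. (\<forall>w. h w v = 0) \<Longrightarrow> v = 0"
    and F: "bilinear F" and e: "inj e" "independent (range e)"
  shows "metric_trace e h F = metric_trace (\<lambda>i. axis i 1) h F"
proof -
  define E :: "real^'m^'m" where "E = (\<chi> i j. e j $ i)"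
  define G :: "real^'m^'m" where "G = (\<chi> i j. h (axis i 1) (axis j 1))"
  define H :: "real^'m^'m" where "H = (\<chi> i j. F (axis i 1) (axis j 1))"
  have col: "column i E = e i" for i
    by (simp add: E_def column_def vec_eq_iff)
  have E: "invertible E"
    unfolding invertible_left_inverse matrix_left_invertible_independent_columns
  proof (intro allI impI)
    fix c i assume "(\<Sum>i\<in>UNIV. c i *s column i E) = 0"
    then have "(\<Sum>v\<in>range e. c (inv e v) *\<^sub>R v) = 0"
      using e(1) by (simp add: sum.reindex col scalar_mult_eq_scaleR)
    then have "c (inv e (e i)) = 0"
      using e(2) independentD[of "range e" "range e" "\<lambda>v. c (inv e v)" "e i"] by simp
    then show "c i = 0" using e(1) by simp
  qed
  have G: "invertible G"
    unfolding invertible_left_inverse matrix_left_invertible_ker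
  proof (intro allI impI)
    fix v assume "G *v v = 0"
    then have "h w v = 0" for w
      by (subst bilinear_matrix[OF h]) (simp add: G_def[symmetric])
    then show "v = 0" using nondeg by blast
  qed
  have ET: "invertible (transpose E)"
    using E by (simp add: transpose_invertible)
  have "metric_trace e h F =
      trace (matrix_inv (transpose E ** G ** E) ** transpose (transpose E ** H ** E))"
    unfolding metric_trace_eq_trace gram_basis_change[OF h, of e] gram_basis_change[OF F, of e]
      E_def G_def H_def ..
  also have "matrix_inv (transpose E ** G ** E) =
      matrix_inv E ** (matrix_inv G ** matrix_inv (transpose E))"
    using E G ET by (simp add: matrix_inv_mult invertible_mult)
  also have "transpose (transpose E ** H ** E) = transpose E ** (transpose H ** E)"
    by (simp add: matrix_transpose_mul)
  also have "matrix_inv E ** (matrix_inv G ** matrix_inv (transpose E)) **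
        (transpose E ** (transpose H ** E)) =
      matrix_inv E ** (matrix_inv G ** (matrix_inv (transpose E) ** transpose E) ** transpose H ** E)"
    by (simp add: matrix_mul_assoc)
  also have "\<dots> = matrix_inv E ** (matrix_inv G ** transpose H ** E)"
    using ET by (simp add: matrix_inv_mat1)
  also have "trace \<dots> = trace (matrix_inv G ** transpose H ** E ** matrix_inv E)"
    by (rule trace_mul_sym)
  also have "matrix_inv G ** transpose H ** E ** matrix_inv E =
      matrix_inv G ** transpose H ** (E ** matrix_inv E)"
    by (simp add: matrix_mul_assoc)
  also have "\<dots> = matrix_inv G ** transpose H"
    using E by (simp add: matrix_inv_mat1)
  finally show ?thesis
    by (simp add: metric_trace_eq_trace G_def H_def)
qed

end

theory Submission
  imports Defs
begin

text \<open>
  In a chart the structures \<open>J\<^sub>2, J\<^sub>3\<close> are self-adjoint for \<open>g\<close> and \<open>J\<^sub>1\<close> is skew. Since \<open>D g = 0\<close>,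
  the covariant derivative of a self-adjoint endomorphism is self-adjoint, so the \<open>J\<^sub>1\<close>-components in
  \<open>D J\<^sub>2 = \<omega>\<^sub>1 J\<^sub>3 - \<omega>\<^sub>3 J\<^sub>1\<close> and \<open>D J\<^sub>3 = \<omega>\<^sub>2 J\<^sub>1 - \<omega>\<^sub>1 J\<^sub>2\<close> vanish
  (\<open>connection_forms_2_3_eq_0\<close>). Every quaternionic Kaehler manifold with Hermitian-Norden metrics
  therefore satisfies \<open>D J\<^sub>1 = 0\<close>, \<open>D J\<^sub>2 = \<omega>\<^sub>1 J\<^sub>3\<close>, \<open>D J\<^sub>3 = - \<omega>\<^sub>1 J\<^sub>2\<close>. Contracting
  with \<open>g\<close> gives \<open>\<theta>\<^sub>2 = \<omega>\<^sub>1 \<circ> J\<^sub>3\<close> and \<open>\<theta>\<^sub>3 = - \<omega>\<^sub>1 \<circ> J\<^sub>2\<close>, the relations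
  between the Lee forms and \<open>\<omega>\<^sub>1\<close> that determine the manifolds of \<open>W13\<close> (\<open>quaternionic_kaehler_iff\<close>).

  It remains to see when \<open>\<omega>\<^sub>1 = 0\<close>. In terms of \<open>\<omega>\<^sub>1\<close> the fundamental tensor is
  \<open>F\<^sub>2(x,y,z) = \<omega>\<^sub>1(x) g(J\<^sub>3 y, z)\<close>. Vanishing of the Lee form gives \<open>\<omega>\<^sub>1 = 0\<close> at once. The condition
  of \<open>W3\<close> says that the symmetric product of \<open>\<omega>\<^sub>1\<close> with the nondegenerate form \<open>g(J\<^sub>3 y, z)\<close>
  vanishes; the condition of \<open>W12\<close>, which follows from each of \<open>W0\<close>, \<open>W1\<close>, \<open>W2\<close>, says that the
  exterior product of \<open>\<omega>\<^sub>1\<close> with the nondegenerate 2-form \<open>g(J\<^sub>1 y, z)\<close> vanishes. Both force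
  \<open>\<omega>\<^sub>1 = 0\<close>, the second because the dimension is at least three (\<open>class_forces_form_zero\<close>),
  so the manifold is hyper-Kaehler.

  A hyper-Kaehler manifold of this kind is flat (\<open>hyper_kaehler_flat\<close>): its curvature commutes
  with \<open>J\<^sub>2\<close> and \<open>J\<^sub>3\<close>. For a self-adjoint parallel structure \<open>J\<close>, the symmetries
  of the Riemannian curvature tensor allow \<open>J\<close> to be moved from any argument to any other:
  \<open>R(J x, y) z = J R(x, y) z\<close>. Moving \<open>J\<^sub>2\<close> and \<open>J\<^sub>3\<close> out of \<open>R(J\<^sub>2 J\<^sub>3 x, y) z\<close> in the two possible
  orders gives \<open>J\<^sub>2 J\<^sub>3 R = J\<^sub>3 J\<^sub>2 R\<close>, whereas \<open>J\<^sub>2 J\<^sub>3 = - J\<^sub>3 J\<^sub>2 = J\<^sub>1\<close> is invertible; hence \<open>R = 0\<close>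
  (\<open>pure_curvature_eq_0\<close>).
\<close>

section \<open>Second derivatives and pointwise linear families\<close>

abbreviation dir_deriv :: "('v::real_normed_vector \<Rightarrow> 'b::real_normed_vector) \<Rightarrow> 'v \<Rightarrow> 'v \<Rightarrow> 'b"
  where "dir_deriv f x u \<equiv> frechet_derivative f (at x) u"

lemma has_real_derivative_along_line:
  fixes f :: "'v::real_normed_vector \<Rightarrow> real"
  assumes "(f has_derivative f') (at (p + s *\<^sub>R u))"
  shows "((\<lambda>s. f (p + s *\<^sub>R u)) has_real_derivative f' u) (at s)"
proof -
  have "((\<lambda>s. p + s *\<^sub>R u) has_derivative (\<lambda>ds. ds *\<^sub>R u)) (at s)"
    by (auto intro!: derivative_eq_intros)
  from has_derivative_compose[OF this assms]
  have "((\<lambda>s. f (p + s *\<^sub>R u)) has_derivative (\<lambda>ds. f' (ds *\<^sub>R u))) (at s)" .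
  then show ?thesis
    using linear_cmul[OF has_derivative_linear[OF assms]]
    by (simp add: has_field_derivative_def mult_commute_abs)
qed

text \<open>
  The mean value theorem in direction \<open>u\<close>, then in direction \<open>v\<close>, turns the second difference over
  a parallelogram into a second derivative at one of its points. The difference is symmetric in \<open>u\<close> and
  \<open>v\<close>, and this is what makes mixed derivatives agree.
\<close>

lemma second_difference_mean_value:
  fixes f :: "'v::real_normed_vector \<Rightarrow> real"
  assumes f': "\<And>y. y \<in> S \<Longrightarrow> (f has_derivative f' y) (at y)"
    and f'': "\<And>y. y \<in> S \<Longrightarrow> ((\<lambda>y. f' y u) has_derivative f'' y) (at y)"
    and h: "0 < h"
    and box: "\<And>s t. \<lbrakk>0 \<le> s; s \<le> h; 0 \<le> t; t \<le> h\<rbrakk> \<Longrightarrow> x + s *\<^sub>R u + t *\<^sub>R v \<in> S"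
  shows "\<exists>s t. 0 \<le> s \<and> s \<le> h \<and> 0 \<le> t \<and> t \<le> h \<and>
    f (x + h *\<^sub>R u + h *\<^sub>R v) - f (x + h *\<^sub>R u) - f (x + h *\<^sub>R v) + f x =
      h * h * f'' (x + s *\<^sub>R u + t *\<^sub>R v) v"
proof -
  \<comment> \<open>the first difference, as a function of the position along \<open>u\<close>\<close>
  define a where "a s = f (x + h *\<^sub>R v + s *\<^sub>R u) - f (x + s *\<^sub>R u)" for s
  have "\<exists>s>0. s < h \<and> a h - a 0 =
      (h - 0) * (f' (x + h *\<^sub>R v + s *\<^sub>R u) u - f' (x + s *\<^sub>R u) u)"
  proof (rule MVT2[OF h])
    fix s assume s: "0 \<le> s" "s \<le> h"
    have "x + h *\<^sub>R v + s *\<^sub>R u \<in> S" "x + s *\<^sub>R u \<in> S"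
      using box[of s h] box[of s 0] s h by (simp_all add: algebra_simps)
    then show "DERIV a s :> f' (x + h *\<^sub>R v + s *\<^sub>R u) u - f' (x + s *\<^sub>R u) u"
      unfolding a_def by (intro DERIV_diff has_real_derivative_along_line f')
  qed
  then obtain s where s: "0 < s" "s < h"
    and a: "a h - a 0 = h * (f' (x + h *\<^sub>R v + s *\<^sub>R u) u - f' (x + s *\<^sub>R u) u)"
    by auto
  have "\<exists>t>0. t < h \<and> f' (x + s *\<^sub>R u + h *\<^sub>R v) u - f' (x + s *\<^sub>R u + 0 *\<^sub>R v) u =
      (h - 0) * f'' (x + s *\<^sub>R u + t *\<^sub>R v) v"
    by (rule MVT2[OF h, of "\<lambda>t. f' (x + s *\<^sub>R u + t *\<^sub>R v) u"
          "\<lambda>t. f'' (x + s *\<^sub>R u + t *\<^sub>R v) v"], rule has_real_derivative_along_line, rule f'')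
      (use s box in auto)
  then obtain t where t: "0 < t" "t < h"
    and "f' (x + s *\<^sub>R u + h *\<^sub>R v) u - f' (x + s *\<^sub>R u) u = h * f'' (x + s *\<^sub>R u + t *\<^sub>R v) v"
    by auto
  with a have "a h - a 0 = h * h * f'' (x + s *\<^sub>R u + t *\<^sub>R v) v"
    by (simp add: algebra_simps)
  moreover have "a h - a 0 =
      f (x + h *\<^sub>R u + h *\<^sub>R v) - f (x + h *\<^sub>R u) - f (x + h *\<^sub>R v) + f x"
    by (simp add: a_def add_ac)
  ultimately show ?thesis
    using s t by (intro exI[of _ s] exI[of _ t]) simp
qed

text \<open>
  Schwarz' theorem: both mixed derivatives are attained, at points of one small parallelogram, as the
  same second difference quotient; by continuity they agree at its corner.
\<close>

lemma mixed_derivatives_commute: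
  fixes f :: "'v::real_normed_vector \<Rightarrow> real"
  assumes S: "open S" "x \<in> S"
    and f': "\<And>y. y \<in> S \<Longrightarrow> (f has_derivative f' y) (at y)"
    and fu: "\<And>y. y \<in> S \<Longrightarrow> ((\<lambda>y. f' y u) has_derivative fu y) (at y)"
    and fv: "\<And>y. y \<in> S \<Longrightarrow> ((\<lambda>y. f' y v) has_derivative fv y) (at y)"
    and cont: "continuous_on S (\<lambda>y. fu y v)" "continuous_on S (\<lambda>y. fv y u)"
  shows "fu x v = fv x u"
proof (rule ccontr)
  define e where "e = \<bar>fu x v - fv x u\<bar> / 2"
  assume "fu x v \<noteq> fv x u"
  then have e: "e > 0" by (simp add: e_def)
  have "isCont (\<lambda>y. fu y v) x" "isCont (\<lambda>y. fv y u) x"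
    using cont S by (simp_all add: continuous_on_eq_continuous_at)
  then obtain d1 d2 where d: "d1 > 0" "\<forall>y. dist y x < d1 \<longrightarrow> dist (fu y v) (fu x v) < e"
      "d2 > 0" "\<forall>y. dist y x < d2 \<longrightarrow> dist (fv y u) (fv x u) < e"
    unfolding continuous_at_eps_delta using e by blast
  obtain d3 where d3: "d3 > 0" "ball x d3 \<subseteq> S"
    using S openE by blast
  define d where "d = min d1 (min d2 d3)"
  have d0: "d > 0" using d d3 by (simp add: d_def)
  \<comment> \<open>a side length for which the parallelogram stays inside the ball of radius \<open>d\<close>\<close>
  define h where "h = d / (1 + norm u + norm v)"
  have pos: "1 + norm u + norm v > 0" by (simp add: add_pos_nonneg)
  then have h: "h > 0" using d0 by (simp add: h_def)
  have "h * (norm u + norm v) < h * (1 + norm u + norm v)"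
    using h by simp
  also have "\<dots> = d" using pos by (simp add: h_def)
  finally have hd: "h * (norm u + norm v) < d" .
  have near: "dist (x + s *\<^sub>R u + t *\<^sub>R v) x < d" if "0 \<le> s" "s \<le> h" "0 \<le> t" "t \<le> h" for s t
  proof -
    have "dist (x + s *\<^sub>R u + t *\<^sub>R v) x \<le> s * norm u + t * norm v"
      using norm_triangle_ineq[of "s *\<^sub>R u" "t *\<^sub>R v"] that by (simp add: dist_norm add.assoc)
    also have "\<dots> \<le> h * norm u + h * norm v"
      using that by (intro add_mono mult_right_mono) auto
    finally show ?thesis using hd by (simp add: distrib_left)
  qed
  have box: "x + s *\<^sub>R u + t *\<^sub>R v \<in> S" if "0 \<le> s" "s \<le> h" "0 \<le> t" "t \<le> h" for s t
    using near[OF that] d3 by (auto simp: d_def dist_commute)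
  define \<Delta> where "\<Delta> = f (x + h *\<^sub>R u + h *\<^sub>R v) - f (x + h *\<^sub>R u) - f (x + h *\<^sub>R v) + f x"
  obtain s t where st: "0 \<le> s" "s \<le> h" "0 \<le> t" "t \<le> h"
    and 1: "\<Delta> = h * h * fu (x + s *\<^sub>R u + t *\<^sub>R v) v"
    using second_difference_mean_value[of S f f' u fu h x v, OF f' fu h box] by (auto simp: \<Delta>_def)
  have box': "x + s *\<^sub>R v + t *\<^sub>R u \<in> S" if "0 \<le> s" "s \<le> h" "0 \<le> t" "t \<le> h" for s t
    using box[of t s] that by (simp add: add_ac)
  obtain t' s' where st': "0 \<le> s'" "s' \<le> h" "0 \<le> t'" "t' \<le> h"
    and 2: "\<Delta> = h * h * fv (x + t' *\<^sub>R v + s' *\<^sub>R u) u"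
    using second_difference_mean_value[of S f f' v fv h x u, OF f' fv h box']
    by (auto simp: \<Delta>_def algebra_simps)
  have "fu (x + s *\<^sub>R u + t *\<^sub>R v) v = fv (x + s' *\<^sub>R u + t' *\<^sub>R v) u"
    using 1 2 h by (simp add: add_ac)
  moreover have "dist (fu (x + s *\<^sub>R u + t *\<^sub>R v) v) (fu x v) < e"
    using near[OF st] d by (simp add: d_def)
  moreover have "dist (fv (x + s' *\<^sub>R u + t' *\<^sub>R v) u) (fv x u) < e"
    using near[OF st'] d by (simp add: d_def)
  ultimately show False
    unfolding e_def dist_real_def by (simp add: abs_if split: if_splits)
qed

lemma smooth_on_differentiable:
  assumes "smooth_on S f" "x \<in> S"
  shows "f differentiable (at x)"
proof -
  have "Ck_on (Suc 0) f S" using assms(1) unfolding smooth_on_def by blast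
  then show ?thesis using assms(2) by simp
qed

lemma smooth_on_has_dir_deriv:
  assumes "smooth_on S f" "x \<in> S"
  shows "(f has_derivative dir_deriv f x) (at x)"
  using smooth_on_differentiable[OF assms] by (simp add: frechet_derivative_works)

text \<open>Pairing with a fixed vector \<open>b\<close> reduces the vector-valued case to the real-valued one.\<close>

lemma smooth_mixed_derivatives_commute:
  fixes f :: "'v::real_normed_vector \<Rightarrow> 'b::real_inner"
  assumes S: "open S" "x \<in> S" and f: "smooth_on S f"
  shows "dir_deriv (\<lambda>y. dir_deriv f y u) x v = dir_deriv (\<lambda>y. dir_deriv f y v) x u"
proof (rule vector_eq_rdot[THEN iffD1], rule allI)
  fix b
  have "Ck_on (Suc (Suc 0)) f S"
    using f unfolding smooth_on_def by blast
  then have 1: "(f has_derivative dir_deriv f y) (at y)"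
    and 2: "((\<lambda>y. dir_deriv f y w) has_derivative dir_deriv (\<lambda>y. dir_deriv f y w) y) (at y)"
    and 3: "continuous_on S (\<lambda>y. dir_deriv (\<lambda>y. dir_deriv f y w) y w')" if "y \<in> S" for y w w'
    using that by (auto simp: frechet_derivative_works)
  show "dir_deriv (\<lambda>y. dir_deriv f y u) x v \<bullet> b = dir_deriv (\<lambda>y. dir_deriv f y v) x u \<bullet> b"
    by (rule mixed_derivatives_commute[OF S, of "\<lambda>y. f y \<bullet> b" "\<lambda>y w. dir_deriv f y w \<bullet> b" u
          "\<lambda>y w. dir_deriv (\<lambda>y. dir_deriv f y u) y w \<bullet> b" v
          "\<lambda>y w. dir_deriv (\<lambda>y. dir_deriv f y v) y w \<bullet> b"])
      (auto intro!: has_derivative_inner_left 1 2 continuous_on_inner continuous_on_const 3[OF S(2)])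
qed

text \<open>
  The Leibniz rule for contractions such as \<open>J Y\<close>, \<open>g(Y, w)\<close>, \<open>\<Gamma>\<^sub>u Y\<close>. Tensor fields are given by the
  smooth maps \<open>y \<mapsto> L y v\<close> with \<open>v\<close> fixed; expanding \<open>Y y\<close> in a basis reduces the rule to products of a
  coordinate of \<open>Y\<close> with such a map.
\<close>

lemma has_derivative_linear_family:
  fixes L :: "'v::real_normed_vector \<Rightarrow> 'e::euclidean_space \<Rightarrow> 'b::real_normed_vector"
  assumes S: "open S" "x \<in> S"
    and lin: "\<And>y. y \<in> S \<Longrightarrow> linear (L y)"
    and L: "\<And>v. (\<lambda>y. L y v) differentiable (at x)"
    and Y: "(Y has_derivative Y') (at x)"
  shows "((\<lambda>y. L y (Y y)) has_derivative
    (\<lambda>u. dir_deriv (\<lambda>y. L y (Y x)) x u + L x (Y' u))) (at x)"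
proof -
  have expand: "L y w = (\<Sum>b\<in>Basis. (w \<bullet> b) *\<^sub>R L y b)" if "y \<in> S" for y w
    using linear_sum[OF lin[OF that], of "\<lambda>b. (w \<bullet> b) *\<^sub>R b" Basis]
    by (simp add: euclidean_representation linear_cmul[OF lin[OF that]])
  have Lb: "((\<lambda>y. L y b) has_derivative dir_deriv (\<lambda>y. L y b) x) (at x)" for b
    using L by (simp add: frechet_derivative_works)
  have *: "((\<lambda>y. L y (Z y)) has_derivative
      (\<lambda>u. (\<Sum>b\<in>Basis. (Z x \<bullet> b) *\<^sub>R dir_deriv (\<lambda>y. L y b) x u + (Z' u \<bullet> b) *\<^sub>R L x b))) (at x)"
    if Z: "(Z has_derivative Z') (at x)" for Z Z'
  proof (rule has_derivative_transform_within_open[OF _ S])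
    show "((\<lambda>y. \<Sum>b\<in>Basis. (Z y \<bullet> b) *\<^sub>R L y b) has_derivative
      (\<lambda>u. (\<Sum>b\<in>Basis. (Z x \<bullet> b) *\<^sub>R dir_deriv (\<lambda>y. L y b) x u + (Z' u \<bullet> b) *\<^sub>R L x b))) (at x)"
      by (intro has_derivative_sum has_derivative_scaleR has_derivative_inner_left Z Lb)
  qed (simp add: expand)
  have "dir_deriv (\<lambda>y. L y (Y x)) x = (\<lambda>u. \<Sum>b\<in>Basis. (Y x \<bullet> b) *\<^sub>R dir_deriv (\<lambda>y. L y b) x u)"
    using *[OF has_derivative_const, of "Y x"] by (simp add: frechet_derivative_at[symmetric])
  with *[OF Y] show ?thesis
    by (simp add: sum.distrib expand[OF S(2), symmetric])
qed

lemma has_derivative_smooth_linear_family: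
  fixes L :: "'v::real_normed_vector \<Rightarrow> 'e::euclidean_space \<Rightarrow> 'b::real_normed_vector"
  assumes S: "open S" "x \<in> S"
    and lin: "\<And>y. y \<in> S \<Longrightarrow> linear (L y)"
    and L: "\<And>v. smooth_on S (\<lambda>y. L y v)" and Y: "smooth_on S Y"
  shows "((\<lambda>y. L y (Y y)) has_derivative
    (\<lambda>u. dir_deriv (\<lambda>y. L y (Y x)) x u + L x (dir_deriv Y x u))) (at x)"
  by (rule has_derivative_linear_family[OF S lin])
    (use S L Y in \<open>auto intro: smooth_on_differentiable smooth_on_has_dir_deriv\<close>)

section \<open>Curvature of the Levi-Civita connection in a chart\<close>

text \<open>Connections and tensor fields are constrained only on the coordinate image, so the identities
  that are differentiated hold only there; the image being open makes this enough.\<close>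

lemma dir_deriv_eqI:
  assumes "open S" "x \<in> S" and "\<And>y. y \<in> S \<Longrightarrow> f y = h y"
    and "(h has_derivative h') (at x)"
  shows "dir_deriv f x u = h' u"
proof -
  have "(f has_derivative h') (at x)"
    using assms by (auto intro: has_derivative_transform_within_open[of h h' x UNIV S f])
  then show ?thesis by (simp add: frechet_derivative_at[symmetric])
qed

lemma cov_constant_field [simp]: "cov \<Gamma> c x u (\<lambda>_. v) = \<Gamma> c x u v"
  by (simp add: cov_def)

lemma curvature_eq:
  "curvature \<Gamma> c x u v w =
     dir_deriv (\<lambda>y. \<Gamma> c y v w) x u - dir_deriv (\<lambda>y. \<Gamma> c y u w) x v
     + \<Gamma> c x u (\<Gamma> c x v w) - \<Gamma> c x v (\<Gamma> c x u w)"
  by (simp add: curvature_def) (simp add: cov_def)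

lemma curvature_skew: "curvature \<Gamma> c x v u w = - curvature \<Gamma> c x u v w"
  by (simp add: curvature_def)

lemma connectionD:
  assumes "connection A \<Gamma>" "c \<in> A"
  shows "x \<in> coord_image c UNIV \<Longrightarrow> linear (\<Gamma> c x u)"
    and "x \<in> coord_image c UNIV \<Longrightarrow> linear (\<lambda>u. \<Gamma> c x u v)"
    and "smooth_on (coord_image c UNIV) (\<lambda>x. \<Gamma> c x u v)"
  using assms by (auto simp: connection_def bilinear_def)

lemma endo_fieldD:
  assumes "endo_field A J" "c \<in> A"
  shows "x \<in> coord_image c UNIV \<Longrightarrow> linear (J c x)"
    and "smooth_on (coord_image c UNIV) (\<lambda>x. J c x v)"
  using assms by (auto simp: endo_field_def)

lemma bilin_fieldD:
  assumes "bilin_field A g" "c \<in> A"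
  shows "x \<in> coord_image c UNIV \<Longrightarrow> bilinear (g c x)"
    and "x \<in> coord_image c UNIV \<Longrightarrow> linear (g c x u)"
    and "x \<in> coord_image c UNIV \<Longrightarrow> linear (\<lambda>u. g c x u v)"
    and "smooth_on (coord_image c UNIV) (\<lambda>x. g c x u v)"
  using assms by (auto simp: bilin_field_def bilinear_def)

lemma levi_civitaD:
  assumes "levi_civita A g \<Gamma>" "c \<in> A" "x \<in> coord_image c UNIV"
  shows levi_civita_connection: "connection A \<Gamma>"
    and levi_civita_torsion_free: "\<Gamma> c x u v = \<Gamma> c x v u"
    and levi_civita_metric:
      "dir_deriv (\<lambda>y. g c y v w) x u = g c x (\<Gamma> c x u v) w + g c x v (\<Gamma> c x u w)"
  using assms by (auto simp: levi_civita_def)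

lemma cov_endo_eq:
  "cov_endo \<Gamma> J c x u v =
     dir_deriv (\<lambda>y. J c y v) x u + \<Gamma> c x u (J c x v) - J c x (\<Gamma> c x u v)"
  by (simp add: cov_endo_def) (simp add: cov_def)

text \<open>Differentiating \<open>g(J v, w) = g(v, J w)\<close> with \<open>D g = 0\<close>.\<close>

lemma cov_endo_self_adjoint:
  assumes lc: "levi_civita A g \<Gamma>" and g: "bilin_field A g" and J: "endo_field A J"
    and c: "c \<in> A" and op: "open (coord_image c UNIV)" and x: "x \<in> coord_image c UNIV"
    and adj: "\<And>y v w. y \<in> coord_image c UNIV \<Longrightarrow> g c y (J c y v) w = g c y v (J c y w)"
  shows "g c x (cov_endo \<Gamma> J c x u v) w = g c x v (cov_endo \<Gamma> J c x u w)"
proof -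
  let ?D = "\<lambda>v. dir_deriv (\<lambda>y. J c y v) x"
  note metric = levi_civita_metric[OF lc c x]
  have J': "smooth_on (coord_image c UNIV) (\<lambda>y. J c y v)" for v
    by (rule endo_fieldD(2)[OF J c])
  have "dir_deriv (\<lambda>y. g c y (J c y v) w) x u =
      dir_deriv (\<lambda>y. g c y (J c x v) w) x u + g c x (?D v u) w"
    by (rule dir_deriv_eqI[OF op x refl])
      (rule has_derivative_smooth_linear_family[OF op x, of "\<lambda>y v. g c y v w"];
        rule bilin_fieldD[OF g c] J'; assumption)
  moreover have "dir_deriv (\<lambda>y. g c y (J c y v) w) x u =
      dir_deriv (\<lambda>y. g c y v (J c x w)) x u + g c x v (?D w u)"
    by (rule dir_deriv_eqI[OF op x adj], assumption)
      (rule has_derivative_smooth_linear_family[OF op x, of "\<lambda>y. g c y v"];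
        rule bilin_fieldD[OF g c] J'; assumption)
  ultimately show ?thesis
    unfolding cov_endo_eq metric
    using adj[OF x]
    by (simp add: linear_add[OF bilin_fieldD(2)[OF g c x]] linear_add[OF bilin_fieldD(3)[OF g c x]]
        linear_diff[OF bilin_fieldD(2)[OF g c x]] linear_diff[OF bilin_fieldD(3)[OF g c x]])
qed

text \<open>
  A parallel \<open>J\<close> satisfies \<open>\<partial>\<^sub>u J = J \<Gamma>\<^sub>u - \<Gamma>\<^sub>u J\<close>. A second derivative \<open>\<partial>\<^sub>v\<close> and antisymmetrization
  in \<open>u\<close> and \<open>v\<close> give zero on the left, by Schwarz' theorem, and \<open>J R - R J\<close> on the right.
\<close>

lemma parallel_endo_commutes_curvature:
  assumes \<Gamma>: "connection A \<Gamma>" and J: "endo_field A J"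
    and c: "c \<in> A" and op: "open (coord_image c UNIV)" and x: "x \<in> coord_image c UNIV"
    and parallel: "\<And>y u v. y \<in> coord_image c UNIV \<Longrightarrow> cov_endo \<Gamma> J c y u v = 0"
  shows "curvature \<Gamma> c x u v (J c x w) = J c x (curvature \<Gamma> c x u v w)"
proof -
  have J': "smooth_on (coord_image c UNIV) (\<lambda>y. J c y v)" for v
    by (rule endo_fieldD(2)[OF J c])
  have \<Gamma>': "smooth_on (coord_image c UNIV) (\<lambda>y. \<Gamma> c y u v)" for u v
    by (rule connectionD(3)[OF \<Gamma> c])
  have dJ: "dir_deriv (\<lambda>y. J c y v) y u = J c y (\<Gamma> c y u v) - \<Gamma> c y u (J c y v)"
    if "y \<in> coord_image c UNIV" for y u v
    using parallel[OF that, of u v] by (simp add: cov_endo_eq algebra_simps)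
  have second: "dir_deriv (\<lambda>y. dir_deriv (\<lambda>y. J c y w) y u) x z =
      (dir_deriv (\<lambda>y. J c y (\<Gamma> c x u w)) x z + J c x (dir_deriv (\<lambda>y. \<Gamma> c y u w) x z)) -
      (dir_deriv (\<lambda>y. \<Gamma> c y u (J c x w)) x z + \<Gamma> c x u (dir_deriv (\<lambda>y. J c y w) x z))" for u z
    by (rule dir_deriv_eqI[OF op x dJ], assumption)
      (rule has_derivative_diff; rule has_derivative_smooth_linear_family[OF op x];
        rule connectionD[OF \<Gamma> c] endo_fieldD[OF J c]; assumption)
  have "dir_deriv (\<lambda>y. dir_deriv (\<lambda>y. J c y w) y u) x v =
      dir_deriv (\<lambda>y. dir_deriv (\<lambda>y. J c y w) y v) x u"
    by (rule smooth_mixed_derivatives_commute[OF op x J'])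
  then show ?thesis
    unfolding second dJ[OF x] curvature_eq
    by (simp add: linear_add[OF endo_fieldD(1)[OF J c x]] linear_diff[OF endo_fieldD(1)[OF J c x]]
        linear_diff[OF connectionD(1)[OF \<Gamma> c x]] algebra_simps)
qed

text \<open>The second derivative of \<open>\<partial>\<^sub>u g(w, z) = g(\<Gamma>\<^sub>u w, z) + g(w, \<Gamma>\<^sub>u z)\<close>, antisymmetrized
  as for a parallel endomorphism: the metric is parallel too.\<close>

lemma curvature_metric_skew:
  assumes lc: "levi_civita A g \<Gamma>" and g: "bilin_field A g"
    and c: "c \<in> A" and op: "open (coord_image c UNIV)" and x: "x \<in> coord_image c UNIV"
  shows "g c x (curvature \<Gamma> c x u v w) z = - g c x w (curvature \<Gamma> c x u v z)"
proof -
  note \<Gamma> = levi_civita_connection[OF lc c x]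
  note metric = levi_civita_metric[OF lc c]
  have second: "dir_deriv (\<lambda>y. dir_deriv (\<lambda>y. g c y w z) y u) x v =
      (dir_deriv (\<lambda>y. g c y (\<Gamma> c x u w) z) x v + g c x (dir_deriv (\<lambda>y. \<Gamma> c y u w) x v) z) +
      (dir_deriv (\<lambda>y. g c y w (\<Gamma> c x u z)) x v + g c x w (dir_deriv (\<lambda>y. \<Gamma> c y u z) x v))" for u v
    by (rule dir_deriv_eqI[OF op x metric], assumption)
      (rule has_derivative_add;
        rule has_derivative_smooth_linear_family[OF op x, of "\<lambda>y v. g c y v z"]
          has_derivative_smooth_linear_family[OF op x, of "\<lambda>y. g c y w"];
        rule connectionD[OF \<Gamma> c] bilin_fieldD[OF g c]; assumption)
  have "dir_deriv (\<lambda>y. dir_deriv (\<lambda>y. g c y w z) y u) x v =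
      dir_deriv (\<lambda>y. dir_deriv (\<lambda>y. g c y w z) y v) x u"
    by (rule smooth_mixed_derivatives_commute[OF op x bilin_fieldD(4)[OF g c]])
  then show ?thesis
    unfolding second metric[OF x] curvature_eq
    by (simp add: linear_add[OF bilin_fieldD(2)[OF g c x]] linear_add[OF bilin_fieldD(3)[OF g c x]]
        linear_diff[OF bilin_fieldD(2)[OF g c x]] linear_diff[OF bilin_fieldD(3)[OF g c x]])
qed

text \<open>With \<open>\<Gamma>\<^sub>u v = \<Gamma>\<^sub>v u\<close>, and hence the same for derivatives of \<open>\<Gamma>\<close>, all terms cancel in pairs.\<close>

lemma first_bianchi:
  assumes lc: "levi_civita A g \<Gamma>"
    and c: "c \<in> A" and op: "open (coord_image c UNIV)" and x: "x \<in> coord_image c UNIV"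
  shows "curvature \<Gamma> c x u v w + curvature \<Gamma> c x v w u + curvature \<Gamma> c x w u v = 0"
proof -
  note \<Gamma> = levi_civita_connection[OF lc c x]
  note torsion_free = levi_civita_torsion_free[OF lc c]
  have "dir_deriv (\<lambda>y. \<Gamma> c y u v) x w = dir_deriv (\<lambda>y. \<Gamma> c y v u) x w" for u v w
    by (rule dir_deriv_eqI[OF op x torsion_free], assumption)
      (rule smooth_on_has_dir_deriv[OF connectionD(3)[OF \<Gamma> c] x])
  note 1 = this[of u v w] this[of v w u] this[of w u v]
  show ?thesis
    unfolding curvature_eq 1 torsion_free[OF x, of u v] torsion_free[OF x, of v w]
      torsion_free[OF x, of w u]
    by simp
qed

section \<open>Algebra of one tangent space\<close>

lemma functionals_common_kernel:
  fixes \<alpha> \<beta> :: "'v::euclidean_space \<Rightarrow> real"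
  assumes "linear \<alpha>" "linear \<beta>" "DIM('v) \<ge> 3"
  obtains y where "y \<noteq> 0" "\<alpha> y = 0" "\<beta> y = 0"
proof -
  let ?a = "adjoint \<alpha> 1" and ?b = "adjoint \<beta> 1"
  have "dim {?a, ?b} \<le> card {?a, ?b}"
    by (rule dim_le_card') simp
  also have "\<dots> < DIM('v)"
    using assms(3) card_insert_le_m1[of 2 "{?b}" ?a] by simp
  finally obtain y where y: "y \<noteq> 0" "\<And>z. z \<in> span {?a, ?b} \<Longrightarrow> orthogonal y z"
    using orthogonal_to_subspace_exists by blast
  have "orthogonal y ?a" "orthogonal y ?b"
    by (auto intro!: y(2) span_base)
  then have "\<alpha> y = 0" "\<beta> y = 0"
    using adjoint_works[OF assms(1), of y 1] adjoint_works[OF assms(2), of y 1]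
    by (simp_all add: orthogonal_def)
  with y(1) show ?thesis by (rule that)
qed

text \<open>
  The cyclic sum is the exterior product of \<open>\<omega>\<close> and \<open>h\<close> when \<open>h\<close> is skew. If \<open>\<omega> x \<noteq> 0\<close>, a nonzero
  \<open>y\<close> killed by both \<open>\<omega>\<close> and \<open>h x\<close> lies in the radical of \<open>h\<close>. The dimension bound is what provides \<open>y\<close>;
  on a plane every 3-form is zero.
\<close>

lemma wedge_nondegenerate_eq_0:
  fixes \<omega> :: "'v::euclidean_space \<Rightarrow> real"
  assumes \<omega>: "linear \<omega>" and h: "\<And>x. linear (h x)" and dim: "DIM('v) \<ge> 3"
    and nondeg: "\<And>y. (\<forall>z. h y z = 0) \<Longrightarrow> y = 0"
    and cyc: "\<And>x y z. \<omega> x * h y z + \<omega> y * h z x + \<omega> z * h x y = 0"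
  shows "\<omega> x = 0"
proof (rule ccontr)
  assume x: "\<omega> x \<noteq> 0"
  obtain y where y: "y \<noteq> 0" "\<omega> y = 0" "h x y = 0"
    using functionals_common_kernel[OF \<omega> h dim] .
  have "h y z = 0" for z
    using cyc[of x y z] x y by simp
  with nondeg y(1) show False by blast
qed

text \<open>Putting \<open>y = z = x\<close> and then \<open>y = x\<close> shows that a vector \<open>x\<close>
  with \<open>\<omega> x \<noteq> 0\<close> is in the radical of \<open>h\<close>.\<close>

lemma symmetric_product_nondegenerate_eq_0:
  fixes \<omega> :: "'v::zero \<Rightarrow> real"
  assumes \<omega>: "\<omega> 0 = 0" and sym: "\<And>x y. h x y = h y x"
    and nondeg: "\<And>y. (\<forall>z. h y z = 0) \<Longrightarrow> y = 0"
    and cyc: "\<And>x y z. \<omega> x * h y z + \<omega> y * h z x + \<omega> z * h x y = 0"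
  shows "\<omega> x = 0"
proof (rule ccontr)
  assume x: "\<omega> x \<noteq> 0"
  have "h x x = 0"
    using cyc[of x x x] x by simp
  then have "h x z = 0" for z
    using cyc[of x x z] x sym[of z x] by simp
  then have "x = 0" using nondeg by blast
  with x \<omega> show False by simp
qed

text \<open>
  The structure induced on a single tangent space. The listed relations imply the remaining
  quaternionic ones.
\<close>

locale hermitian_norden_space =
  fixes g :: "'v::euclidean_space \<Rightarrow> 'v \<Rightarrow> real" and J1 J2 J3 :: "'v \<Rightarrow> 'v"
  assumes g: "bilinear g" and g_sym: "g v w = g w v"
    and nondeg: "(\<forall>w. g v w = 0) \<Longrightarrow> v = 0"
    and J1: "linear J1" and J2: "linear J2" and J3: "linear J3"
    and J23: "J2 (J3 v) = J1 v" and J32: "J3 (J2 v) = - J1 v"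
    and J11: "J1 (J1 v) = - v" and J22: "J2 (J2 v) = - v" and J33: "J3 (J3 v) = - v"
    and g_J1: "g (J1 v) (J1 w) = g v w"
    and g_J2: "g (J2 v) (J2 w) = - g v w" and g_J3: "g (J3 v) (J3 w) = - g v w"
begin

lemmas g_simps = bilinear_ladd[OF g] bilinear_radd[OF g] bilinear_lmul[OF g] bilinear_rmul[OF g]
  bilinear_lneg[OF g] bilinear_rneg[OF g] bilinear_lsub[OF g] bilinear_rsub[OF g]

lemma J1_skew: "g (J1 v) w = - g v (J1 w)"
  using g_J1[of "J1 v" w] by (simp add: J11 g_simps)

lemma J2_self_adjoint: "g (J2 v) w = g v (J2 w)"
  using g_J2[of "J2 v" w] by (simp add: J22 g_simps)

lemma J3_self_adjoint: "g (J3 v) w = g v (J3 w)"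
  using g_J3[of "J3 v" w] by (simp add: J33 g_simps)

lemma J1_eq_0: "J1 v = 0 \<Longrightarrow> v = 0" and J2_eq_0: "J2 v = 0 \<Longrightarrow> v = 0"
  and J3_eq_0: "J3 v = 0 \<Longrightarrow> v = 0"
  using J11[of v] J22[of v] J33[of v] by (auto simp: linear_0 J1 J2 J3)

lemma self_adjoint_no_J1_part:
  assumes K: "\<And>v w. g (K v) w = g v (K w)"
    and adj: "\<And>v w. g (a *\<^sub>R K v + b *\<^sub>R J1 v) w = g v (a *\<^sub>R K w + b *\<^sub>R J1 w)"
  shows "b = 0"
proof (rule ccontr)
  assume b: "b \<noteq> 0"
  obtain v :: 'v where v: "v \<noteq> 0"
    using nonzero_Basis by (metis SOME_Basis)
  have "g (J1 v) w = 0" for w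
    using adj[of v w] K[of v w] J1_skew[of v w] b by (simp add: g_simps)
  then show False
    using nondeg J1_eq_0 v by blast
qed

text \<open>
  For \<open>F(x,y,z) = \<omega>(x) g(J\<^sub>3 y, z)\<close> the cyclic sum of \<open>F(x, y, J\<^sub>2 z) = \<omega>(x) g(J\<^sub>1 y, z)\<close> is an exterior
  product and that of \<open>F(x, y, z)\<close> a symmetric product, both with nondegenerate second factor.
\<close>

lemma class_forces_form_zero:
  assumes C: "C \<in> {W0, W1, W2, W12, W23, W3}" and dim: "DIM('v) \<ge> 3"
    and \<omega>: "linear \<omega>"
    and F: "\<And>x y z. F x y z = \<omega> x * g (J3 y) z" and \<theta>: "\<And>z. \<theta> z = \<omega> (J3 z)"
    and in_C: "class_cond C n g J2 F \<theta>"
  shows "\<omega> u = 0"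
proof -
  note \<omega>_simps = linear_0[OF \<omega>] linear_neg[OF \<omega>]
  have W12: "\<omega> u = 0" if "class_cond W12 n g J2 F \<theta>"
  proof (rule wedge_nondegenerate_eq_0[OF \<omega> _ dim])
    show "linear (g (J1 x))" for x
      using g by (simp add: bilinear_def)
    show "y = 0" if "\<forall>z. g (J1 y) z = 0" for y
      using that nondeg J1_eq_0 by blast
    show "\<omega> x * g (J1 y) z + \<omega> y * g (J1 z) x + \<omega> z * g (J1 x) y = 0" for x y z
      using \<open>class_cond W12 n g J2 F \<theta>\<close> by (simp add: cyc_def F J2_self_adjoint[symmetric] J23)
  qed
  consider "C \<in> {W0, W1, W2, W12}" | "C = W23" | "C = W3"
    using C by auto
  then show ?thesis
  proof cases
    case 1
    \<comment> \<open>\<open>W1\<close> is contained in \<open>W12\<close>: the terms of the cyclic sum cancel in pairs, by \<open>J2 (J2 z) = - z\<close> and the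
      symmetry of \<open>g x (J2 y)\<close>.\<close>
    have "class_cond W12 n g J2 F \<theta>" if "class_cond W1 n g J2 F \<theta>"
    proof -
      have "F x y (J2 z) = 1 / (4 * real n) *
          (g x y * \<theta> (J2 z) - g x z * \<theta> (J2 y) + g x (J2 z) * \<theta> y - g x (J2 y) * \<theta> z)" for x y z
        using that by (simp add: J22 \<theta> linear_neg[OF J3] \<omega>_simps g_simps)
      moreover have "g x (J2 y) = g y (J2 x)" for x y
        using J2_self_adjoint[of y x] g_sym by simp
      ultimately show ?thesis
        by (simp add: cyc_def) (simp add: g_sym algebra_simps add_divide_distrib diff_divide_distrib)
    qed
    with 1 in_C have "class_cond W12 n g J2 F \<theta>"
      by (auto simp: cyc_def)
    then show ?thesis by (rule W12)
  next
    case 2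
    then have "\<theta> (J3 u) = 0" using in_C by simp
    then show ?thesis by (simp add: \<theta> J33 \<omega>_simps)
  next
    case 3
    show ?thesis
    proof (rule symmetric_product_nondegenerate_eq_0[where h = "\<lambda>y z. g (J3 y) z"])
      show "\<omega> 0 = 0" by (rule \<omega>_simps)
      show "g (J3 x) y = g (J3 y) x" for x y
        using J3_self_adjoint g_sym by metis
      show "y = 0" if "\<forall>z. g (J3 y) z = 0" for y
        using that nondeg J3_eq_0 by blast
      show "\<omega> x * g (J3 y) z + \<omega> y * g (J3 z) x + \<omega> z * g (J3 x) y = 0" for x y z
        using in_C 3 by (simp add: cyc_def F)
    qed
  qed
qed

text \<open>
  Complex linearity of \<open>R\<close> in the last argument spreads to the first one, for both \<open>J\<^sub>2\<close> and \<open>J\<^sub>3\<close>.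
  Since these anticommute, taking one of them out of the first and the other out of the last argument
  changes the order of the two, and hence the sign of \<open>J\<^sub>1 (R x y z)\<close>.
\<close>

lemma pure_curvature_eq_0:
  fixes R :: "'v \<Rightarrow> 'v \<Rightarrow> 'v \<Rightarrow> 'v"
  assumes skew: "\<And>x y z. R y x z = - R x y z"
    and bianchi: "\<And>x y z. R x y z + R y z x + R z x y = 0"
    and metric: "\<And>x y z w. g (R x y z) w = - g z (R x y w)"
    and RJ2: "\<And>x y z. R x y (J2 z) = J2 (R x y z)"
    and RJ3: "\<And>x y z. R x y (J3 z) = J3 (R x y z)"
  shows "R x y z = 0"
proof -
  have pair_sym: "g (R x y z) w = g (R z w x) y" for x y z w
  proof -
    have skew': "g (R y x z) w = - g (R x y z) w"
      and metric': "g (R x y w) z = - g (R x y z) w" for x y z w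
      using skew[of x y z] metric[of x y z w] g_sym by (simp_all add: g_simps)
    have bianchi': "g (R x y z) w + g (R y z x) w + g (R z x y) w = 0" for x y z w
      using arg_cong[OF bianchi[of x y z], of "\<lambda>v. g v w"] bilinear_lzero[OF g]
      by (simp add: g_simps)
    show ?thesis
      using bianchi'[of x y z w] bianchi'[of y z w x] bianchi'[of z w x y] bianchi'[of w x y z]
        skew'[of x y] skew'[of x z] skew'[of x w] skew'[of y z] skew'[of y w] skew'[of z w]
        metric'[of x y z w] metric'[of x z y w] metric'[of x w y z]
        metric'[of y z x w] metric'[of y w x z] metric'[of z w x y]
      by smt
  qed
  have shift: "R (K y) z x = K (R y z x)"
    if adj: "\<And>v w. g (K v) w = g v (K w)" and RK: "\<And>x y z. R x y (K z) = K (R x y z)"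
      and K: "linear K" for K x y z
  proof -
    \<comment> \<open>pair symmetry moves \<open>K\<close> to the second pair, where it commutes with \<open>R\<close> and is self-adjoint\<close>
    have 1: "R (K x) y z = R x (K y) z" for x y z
    proof -
      have "g (R (K x) y z - R x (K y) z) w = 0" for w
        using pair_sym[of "K x" y z w] pair_sym[of x "K y" z w]
        by (simp add: g_simps RK adj)
      then show ?thesis using nondeg[of "R (K x) y z - R x (K y) z"] by simp
    qed
    \<comment> \<open>The defect \<open>T\<close> is skew in its last two arguments and, by the Bianchi identity, symmetric in its
      first two; such a tensor is zero.\<close>
    define T where "T x y z = R y z (K x) - R (K y) z x" for x y z
    have T_skew: "T x z y = - T x y z" for x y z
      using skew[of y z "K x"] skew[of "K z" y x] 1[of y z x] by (simp add: T_def)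
    have T_sym: "T x y z = T y x z" for x y z
    proof -
      have "R x y (K z) + R y z (K x) + R z x (K y) = K (R x y z + R y z x + R z x y)"
        by (simp add: RK linear_add[OF K])
      then have a: "R x y (K z) + R y z (K x) + R z x (K y) = 0"
        by (simp add: bianchi linear_0[OF K])
      have b: "R x y (K z) + R (K y) z x + R z (K x) y = 0"
        using bianchi[of x y "K z"] by (simp add: 1)
      from a b have "R y z (K x) + R z x (K y) = R (K y) z x + R z (K x) y"
        by (metis add.assoc add_left_imp_eq)
      then show ?thesis
        using skew[of x z "K y"] skew[of "K x" z y] by (simp add: T_def algebra_simps)
    qed
    \<comment> \<open>alternate the two symmetries three times each\<close>
    have "T x y z = - T x y z"
      by (metis T_sym T_skew)
    then have "T x y z = 0"
      by (simp add: eq_neg_iff_add_eq_0 scaleR_2[symmetric])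
    then show ?thesis by (simp add: T_def RK)
  qed
  note s2 = shift[OF J2_self_adjoint RJ2 J2] and s3 = shift[OF J3_self_adjoint RJ3 J3]
  have "J1 (R x y z) = R (J2 (J3 x)) y z"
    by (simp only: s2 s3 J23[symmetric])
  also have "\<dots> = R (J3 x) y (J2 z)"
    by (simp only: s2 RJ2)
  also have "\<dots> = J3 (J2 (R x y z))"
    unfolding s3 RJ2[symmetric] ..
  also have "\<dots> = - J1 (R x y z)"
    by (rule J32)
  finally have "J1 (R x y z) = 0"
    by (simp add: eq_neg_iff_add_eq_0 scaleR_2[symmetric])
  then show ?thesis by (rule J1_eq_0)
qed

end

text \<open>The inverse Gram matrix of \<open>h\<close> cancels the Gram matrix that occurs in \<open>h v z\<close>.\<close>

lemma metric_trace_contraction: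
  fixes h :: "real^'m::finite \<Rightarrow> real^'m \<Rightarrow> real"
  assumes h: "bilinear h" and nondeg: "\<And>v. (\<forall>w. h w v = 0) \<Longrightarrow> v = 0"
    and \<omega>: "linear \<omega>"
  shows "metric_trace (\<lambda>i. axis i 1) h (\<lambda>u v. \<omega> u * h v z) = \<omega> z"
proof -
  define G :: "real^'m^'m" where "G = (\<chi> i j. h (axis i 1) (axis j 1))"
  have hG: "h u v = u \<bullet> (G *v v)" for u v
    unfolding G_def by (rule bilinear_matrix[OF h])
  have G: "invertible G"
    unfolding invertible_left_inverse matrix_left_invertible_ker
    using nondeg by (auto simp: hG)
  have "metric_trace (\<lambda>i. axis i 1) h (\<lambda>u v. \<omega> u * h v z) =
      (\<Sum>i\<in>UNIV. (matrix_inv G *v (G *v z)) $ i * \<omega> (axis i 1))"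
    unfolding metric_trace_def G_def[symmetric]
    by (simp add: hG inner_axis' matrix_vector_mult_def[of "matrix_inv G"] sum_distrib_left
        sum_distrib_right mult_ac)
  also have "matrix_inv G *v (G *v z) = z"
    by (simp add: matrix_vector_mul_assoc matrix_inv_mat1[OF G])
  also have "(\<Sum>i\<in>UNIV. z $ i * \<omega> (axis i 1)) = \<omega> (\<Sum>i\<in>UNIV. z $ i *\<^sub>R axis i 1)"
    by (simp add: linear_sum[OF \<omega>] linear_cmul[OF \<omega>])
  also have "(\<Sum>i\<in>UNIV. z $ i *\<^sub>R axis i 1) = z"
    using basis_expansion[of z] by (simp add: scalar_mult_eq_scaleR)
  finally show ?thesis .
qed

section \<open>Quaternionic Kaehler manifolds with Hermitian-Norden metrics\<close>

lemma hermitian_norden_manifoldD: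
  fixes A :: "('a, 'm::finite) chart set"
  assumes "hermitian_norden_manifold n X A J g"
  shows hermitian_norden_endo_field: "a \<in> {1, 2, 3} \<Longrightarrow> endo_field A (J a)"
    and hermitian_norden_bilin_field: "bilin_field A g"
    and hermitian_norden_open: "c \<in> A \<Longrightarrow> open (coord_image c UNIV)"
    and hermitian_norden_domain: "c \<in> A \<Longrightarrow> fst c \<subseteq> topspace X"
    and hermitian_norden_dim: "CARD('m) \<ge> 4"
proof -
  have "CARD('m) > 0" by simp
  then show "CARD('m) \<ge> 4"
    using assms unfolding hermitian_norden_manifold_def by (cases n) auto
  show "c \<in> A \<Longrightarrow> open (coord_image c UNIV)" "c \<in> A \<Longrightarrow> fst c \<subseteq> topspace X"
    using assms by (auto simp: hermitian_norden_manifold_def smooth_manifold_def coord_image_def)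
qed (use assms in \<open>auto simp: hermitian_norden_manifold_def almost_hypercomplex_def neutral_metric_def\<close>)

lemma hermitian_norden_space_at:
  assumes M: "hermitian_norden_manifold n X A J g" and c: "c \<in> A" and x: "x \<in> coord_image c UNIV"
  shows "hermitian_norden_space (g c x) (J 1 c x) (J 2 c x) (J 3 c x)"
proof (rule hermitian_norden_space.intro)
  have lin: "linear (J a c x)" if "a \<in> {1, 2, 3}" for a
    using endo_fieldD(1)[OF hermitian_norden_endo_field[OF M that] c x] .
  show "linear (J 1 c x)" "linear (J 2 c x)" "linear (J 3 c x)"
    by (simp_all add: lin)
  show "bilinear (g c x)"
    by (rule bilin_fieldD(1)[OF hermitian_norden_bilin_field[OF M] c x])
  show "g c x v w = g c x w v" "\<forall>w. g c x v w = 0 \<Longrightarrow> v = 0" for v w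
    using M c x unfolding hermitian_norden_manifold_def neutral_metric_def by blast+
  have "\<forall>(a, b, d)\<in>cyclic123. \<forall>c\<in>A. \<forall>x\<in>coord_image c UNIV. \<forall>v.
      J a c x v = J b c x (J d c x v) \<and> J a c x v = - J d c x (J b c x v) \<and> J a c x (J a c x v) = - v"
    using M unfolding hermitian_norden_manifold_def almost_hypercomplex_def by (elim conjE)
  then have q: "J 1 c x v = J 2 c x (J 3 c x v)" "J 1 c x v = - J 3 c x (J 2 c x v)"
      "J 1 c x (J 1 c x v) = - v" "J 2 c x (J 2 c x v) = - v" "J 3 c x (J 3 c x v) = - v" for v
    using c x unfolding cyclic123_def ball_simps prod.case by metis+
  show "J 2 c x (J 3 c x v) = J 1 c x v" "J 3 c x (J 2 c x v) = - J 1 c x v" for v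
    using q(1,2)[of v] by simp_all
  show "J 1 c x (J 1 c x v) = - v" "J 2 c x (J 2 c x v) = - v" "J 3 c x (J 3 c x v) = - v" for v
    by (rule q)+
  have sign: "g c x v w = hn_sign a * g c x (J a c x v) (J a c x w)" if "a \<in> {1, 2, 3}" for a v w
    using M c x that unfolding hermitian_norden_manifold_def by blast
  show "g c x (J 1 c x v) (J 1 c x w) = g c x v w" for v w
    using sign[of 1 v w] by (simp add: hn_sign_def)
  show "g c x (J 2 c x v) (J 2 c x w) = - g c x v w" for v w
    using sign[of 2 v w] by (simp add: hn_sign_def)
  show "g c x (J 3 c x v) (J 3 c x w) = - g c x v w" for v w
    using sign[of 3 v w] by (simp add: hn_sign_def)
qed

text \<open>\<open>D J\<^sub>2\<close> and \<open>D J\<^sub>3\<close> are self-adjoint like \<open>J\<^sub>2\<close> and \<open>J\<^sub>3\<close>, whereas \<open>J\<^sub>1\<close> is skew.\<close>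

lemma connection_forms_2_3_eq_0:
  assumes M: "hermitian_norden_manifold n X A J g" and lc: "levi_civita A g \<Gamma>"
    and c: "c \<in> A" and x: "x \<in> coord_image c UNIV"
    and D2: "\<And>v. cov_endo \<Gamma> (J 2) c x u v = \<omega>1 *\<^sub>R J 3 c x v - \<omega>3 *\<^sub>R J 1 c x v"
    and D3: "\<And>v. cov_endo \<Gamma> (J 3) c x u v = \<omega>2 *\<^sub>R J 1 c x v - \<omega>1 *\<^sub>R J 2 c x v"
  shows "\<omega>2 = 0" "\<omega>3 = 0"
proof -
  interpret hermitian_norden_space "g c x" "J 1 c x" "J 2 c x" "J 3 c x"
    by (rule hermitian_norden_space_at[OF M c x])
  have adj: "g c x (cov_endo \<Gamma> (J a) c x u v) w = g c x v (cov_endo \<Gamma> (J a) c x u w)"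
    if a: "a \<in> {2, 3}" for a v w
  proof (rule cov_endo_self_adjoint[OF lc hermitian_norden_bilin_field[OF M]
        hermitian_norden_endo_field[OF M] c hermitian_norden_open[OF M c] x])
    show "a \<in> {1, 2, 3}" using a by auto
    show "g c y (J a c y v) w = g c y v (J a c y w)" if y: "y \<in> coord_image c UNIV" for y v w
      using hermitian_norden_space.J2_self_adjoint[OF hermitian_norden_space_at[OF M c y], of v w]
        hermitian_norden_space.J3_self_adjoint[OF hermitian_norden_space_at[OF M c y], of v w] a
      by auto
  qed
  have "- \<omega>3 = 0"
    by (rule self_adjoint_no_J1_part[of "J 3 c x" \<omega>1, OF J3_self_adjoint])
      (use adj[of 2] in \<open>simp add: D2\<close>)
  then show "\<omega>3 = 0" by simp
  show "\<omega>2 = 0"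
    by (rule self_adjoint_no_J1_part[of "J 2 c x" "- \<omega>1", OF J2_self_adjoint])
      (use adj[of 3] in \<open>simp add: D3\<close>)
qed

lemma lee_forms:
  assumes M: "hermitian_norden_manifold n X A J g"
    and c: "c \<in> A" and x: "x \<in> coord_image c UNIV" and \<omega>: "linear \<omega>"
    and D2: "\<And>u v. cov_endo \<Gamma> (J 2) c x u v = \<omega> u *\<^sub>R J 3 c x v"
    and D3: "\<And>u v. cov_endo \<Gamma> (J 3) c x u v = - \<omega> u *\<^sub>R J 2 c x v"
  shows lee_form_2: "lee J g \<Gamma> 2 c x z = \<omega> (J 3 c x z)"
    and lee_form_3: "lee J g \<Gamma> 3 c x z = - \<omega> (J 2 c x z)"
proof -
  interpret hermitian_norden_space "g c x" "J 1 c x" "J 2 c x" "J 3 c x"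
    by (rule hermitian_norden_space_at[OF M c x])
  have nondeg': "v = 0" if "\<forall>w. g c x w v = 0" for v
    using that nondeg[of v] g_sym by metis
  note contraction = metric_trace_contraction[OF g nondeg']
  have "lee J g \<Gamma> 2 c x z = metric_trace (\<lambda>i. axis i 1) (g c x) (\<lambda>u v. \<omega> u * g c x v (J 3 c x z))"
    by (simp add: lee_def fund_def D2 g_simps J3_self_adjoint)
  also have "\<dots> = \<omega> (J 3 c x z)"
    by (rule contraction[OF _ \<omega>])
  finally show "lee J g \<Gamma> 2 c x z = \<omega> (J 3 c x z)" .
  have \<omega>': "linear (\<lambda>u. - \<omega> u)"
    using \<omega> by (rule linear_compose_neg)
  have "lee J g \<Gamma> 3 c x z = metric_trace (\<lambda>i. axis i 1) (g c x) (\<lambda>u v. - \<omega> u * g c x v (J 2 c x z))"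
    by (simp add: lee_def fund_def D3 g_simps J2_self_adjoint)
  also have "\<dots> = - \<omega> (J 2 c x z)"
    by (rule contraction[OF _ \<omega>'])
  finally show "lee J g \<Gamma> 3 c x z = - \<omega> (J 2 c x z)" .
qed

lemma coord_image_mono: "coord_image c W \<subseteq> coord_image c UNIV"
  by (auto simp: coord_image_def)

lemma oneform_on_linear:
  assumes "oneform_on A W \<omega>" "c \<in> A" "x \<in> coord_image c W"
  shows "linear (\<omega> c x)"
  using assms by (auto simp: oneform_on_def)

lemma smooth_on_0: "smooth_on S (\<lambda>_. 0 :: 'b::real_normed_vector)"
proof -
  have "Ck_on k (\<lambda>_. 0 :: 'b) S" for k
    by (induction k) (simp_all)
  then show ?thesis by (simp add: smooth_on_def)
qed

lemma oneform_on_0: "oneform_on A W (\<lambda>_ _ _. 0)"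
  by (simp add: oneform_on_def smooth_on_0 linear_zero)

text \<open>For the converse, the local forms \<open>(\<omega>\<^sub>1, 0, 0)\<close> are associated to the triple.\<close>

lemma quaternionic_kaehler_iff:
  assumes M: "hermitian_norden_manifold n X A J g" and lc: "levi_civita A g \<Gamma>"
  shows "quaternionic_kaehler X A J \<Gamma> \<longleftrightarrow>
    (\<forall>p\<in>topspace X. \<exists>W \<omega>1. openin X W \<and> p \<in> W \<and> oneform_on A W \<omega>1 \<and>
      (\<forall>c\<in>A. \<forall>x\<in>coord_image c W. \<forall>u v.
        cov_endo \<Gamma> (J 1) c x u v = 0 \<and>
        cov_endo \<Gamma> (J 2) c x u v = \<omega>1 c x u *\<^sub>R J 3 c x v \<and>
        \<omega>1 c x u = - lee J g \<Gamma> 2 c x (J 3 c x u) \<and>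
        cov_endo \<Gamma> (J 3) c x u v = - \<omega>1 c x u *\<^sub>R J 2 c x v \<and>
        \<omega>1 c x u = lee J g \<Gamma> 3 c x (J 2 c x u)))"
    (is "?QK \<longleftrightarrow> ?local")
proof
  assume QK: ?QK
  show ?local
  proof
    fix p assume "p \<in> topspace X"
    then obtain W \<omega> where W: "openin X W" "p \<in> W"
      and \<omega>: "\<forall>a\<in>{1, 2, 3}. oneform_on A W (\<omega> a)"
      and D: "\<forall>(a, b, d)\<in>cyclic123. \<forall>c\<in>A. \<forall>x\<in>coord_image c W. \<forall>u v.
        cov_endo \<Gamma> (J a) c x u v = \<omega> d c x u *\<^sub>R J b c x v - \<omega> b c x u *\<^sub>R J d c x v"
      by (elim bspec[OF QK[unfolded quaternionic_kaehler_def], elim_format] exE conjE) (rule that)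
    have forms: "cov_endo \<Gamma> (J 1) c x u v = 0 \<and>
        cov_endo \<Gamma> (J 2) c x u v = \<omega> 1 c x u *\<^sub>R J 3 c x v \<and>
        \<omega> 1 c x u = - lee J g \<Gamma> 2 c x (J 3 c x u) \<and>
        cov_endo \<Gamma> (J 3) c x u v = - \<omega> 1 c x u *\<^sub>R J 2 c x v \<and>
        \<omega> 1 c x u = lee J g \<Gamma> 3 c x (J 2 c x u)"
      if c: "c \<in> A" and xW: "x \<in> coord_image c W" for c x u v
    proof -
      have x: "x \<in> coord_image c UNIV"
        using xW coord_image_mono by blast
      interpret hermitian_norden_space "g c x" "J 1 c x" "J 2 c x" "J 3 c x"
        by (rule hermitian_norden_space_at[OF M c x])
      have D123: "cov_endo \<Gamma> (J 1) c x u v = \<omega> 3 c x u *\<^sub>R J 2 c x v - \<omega> 2 c x u *\<^sub>R J 3 c x v"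
        "cov_endo \<Gamma> (J 2) c x u v = \<omega> 1 c x u *\<^sub>R J 3 c x v - \<omega> 3 c x u *\<^sub>R J 1 c x v"
        "cov_endo \<Gamma> (J 3) c x u v = \<omega> 2 c x u *\<^sub>R J 1 c x v - \<omega> 1 c x u *\<^sub>R J 2 c x v" for u v
        using D c xW by (simp_all add: cyclic123_def del: One_nat_def)
      have "\<omega> 2 c x u = 0" "\<omega> 3 c x u = 0" for u
        using connection_forms_2_3_eq_0[where u = u, OF M lc c x D123(2,3)] by simp_all
      then have D1: "cov_endo \<Gamma> (J 1) c x u v = 0"
        and D2: "cov_endo \<Gamma> (J 2) c x u v = \<omega> 1 c x u *\<^sub>R J 3 c x v"
        and D3: "cov_endo \<Gamma> (J 3) c x u v = - \<omega> 1 c x u *\<^sub>R J 2 c x v" for u v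
        by (simp_all add: D123 del: One_nat_def)
      have lin: "linear (\<omega> 1 c x)"
        using \<omega> oneform_on_linear[OF _ c xW] by blast
      show ?thesis
        unfolding lee_form_2[OF M c x lin D2 D3] lee_form_3[OF M c x lin D2 D3] J22 J33
        using D1 D2 D3 by (simp add: linear_neg[OF lin] del: One_nat_def)
    qed
    have \<omega>1: "oneform_on A W (\<omega> 1)"
      using \<omega> by simp
    show "\<exists>W \<omega>1. openin X W \<and> p \<in> W \<and> oneform_on A W \<omega>1 \<and>
      (\<forall>c\<in>A. \<forall>x\<in>coord_image c W. \<forall>u v.
        cov_endo \<Gamma> (J 1) c x u v = 0 \<and>
        cov_endo \<Gamma> (J 2) c x u v = \<omega>1 c x u *\<^sub>R J 3 c x v \<and>
        \<omega>1 c x u = - lee J g \<Gamma> 2 c x (J 3 c x u) \<and>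
        cov_endo \<Gamma> (J 3) c x u v = - \<omega>1 c x u *\<^sub>R J 2 c x v \<and>
        \<omega>1 c x u = lee J g \<Gamma> 3 c x (J 2 c x u))"
      by (intro exI[of _ W] exI[of _ "\<omega> 1"] conjI W \<omega>1) (intro ballI allI forms)
  qed
next
  assume ?local
  show ?QK
    unfolding quaternionic_kaehler_def
  proof
    fix p assume "p \<in> topspace X"
    then obtain W \<omega>1 where W: "openin X W" "p \<in> W" "oneform_on A W \<omega>1"
      and D: "\<forall>c\<in>A. \<forall>x\<in>coord_image c W. \<forall>u v.
        cov_endo \<Gamma> (J 1) c x u v = 0 \<and>
        cov_endo \<Gamma> (J 2) c x u v = \<omega>1 c x u *\<^sub>R J 3 c x v \<and>
        \<omega>1 c x u = - lee J g \<Gamma> 2 c x (J 3 c x u) \<and>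
        cov_endo \<Gamma> (J 3) c x u v = - \<omega>1 c x u *\<^sub>R J 2 c x v \<and>
        \<omega>1 c x u = lee J g \<Gamma> 3 c x (J 2 c x u)"
      by (elim bspec[OF \<open>?local\<close>, elim_format] exE conjE) (rule that)
    define \<omega> :: "nat \<Rightarrow> ('a, 'b) oneform" where
      "\<omega> a = (if a = 1 then \<omega>1 else (\<lambda>_ _ _. 0))" for a
    show "\<exists>W \<omega>. openin X W \<and> p \<in> W \<and> (\<forall>a\<in>{1, 2, 3}. oneform_on A W (\<omega> a)) \<and>
        (\<forall>(a, b, d)\<in>cyclic123. \<forall>c\<in>A. \<forall>x\<in>coord_image c W. \<forall>u v.
           cov_endo \<Gamma> (J a) c x u v =
             \<omega> d c x u *\<^sub>R J b c x v - \<omega> b c x u *\<^sub>R J d c x v)"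
      using W D by (intro exI[of _ W] exI[of _ \<omega>])
        (simp add: \<omega>_def oneform_on_0 cyclic123_def del: One_nat_def)
  qed
qed

text \<open>The local form, chosen in a neighbourhood, gives a functional on each single tangent space; on
  that level the class conditions can be applied.\<close>

lemma quaternionic_kaehler_at:
  assumes M: "hermitian_norden_manifold n X A J g" and lc: "levi_civita A g \<Gamma>"
    and QK: "quaternionic_kaehler X A J \<Gamma>" and c: "c \<in> A" and x: "x \<in> coord_image c UNIV"
  obtains \<omega> where "linear \<omega>"
    and "\<And>u v. cov_endo \<Gamma> (J 1) c x u v = 0"
    and "\<And>u v. cov_endo \<Gamma> (J 2) c x u v = \<omega> u *\<^sub>R J 3 c x v"
    and "\<And>u v. cov_endo \<Gamma> (J 3) c x u v = - \<omega> u *\<^sub>R J 2 c x v"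
proof -
  obtain p where p: "p \<in> fst c" "x = snd c p"
    using x by (auto simp: coord_image_def)
  then have "p \<in> topspace X"
    using hermitian_norden_domain[OF M c] by blast
  then obtain W \<omega>1 where W: "p \<in> W" "oneform_on A W \<omega>1"
    and D: "\<forall>c\<in>A. \<forall>x\<in>coord_image c W. \<forall>u v.
        cov_endo \<Gamma> (J 1) c x u v = 0 \<and>
        cov_endo \<Gamma> (J 2) c x u v = \<omega>1 c x u *\<^sub>R J 3 c x v \<and>
        \<omega>1 c x u = - lee J g \<Gamma> 2 c x (J 3 c x u) \<and>
        cov_endo \<Gamma> (J 3) c x u v = - \<omega>1 c x u *\<^sub>R J 2 c x v \<and>
        \<omega>1 c x u = lee J g \<Gamma> 3 c x (J 2 c x u)"
    by (elim bspec[OF QK[unfolded quaternionic_kaehler_iff[OF M lc]], elim_format] exE conjE)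
      (rule that)
  have xW: "x \<in> coord_image c W"
    using p W(1) by (auto simp: coord_image_def)
  show ?thesis
    using that[of "\<omega>1 c x"] bspec[OF bspec[OF D c] xW] oneform_on_linear[OF W(2) c xW] by simp
qed

lemma quaternionic_kaehler_class_hyper_kaehler:
  assumes M: "hermitian_norden_manifold n X A J g" and lc: "levi_civita A g \<Gamma>"
    and QK: "quaternionic_kaehler X A J \<Gamma>"
    and C: "C \<in> {W0, W1, W2, W12, W23, W3}" and in_C: "in_class C n A J g \<Gamma>"
  shows "hyper_kaehler A J \<Gamma>"
proof -
  have "cov_endo \<Gamma> (J a) c x u v = 0"
    if a: "a \<in> {1, 2, 3}" and c: "c \<in> A" and x: "x \<in> coord_image c UNIV" for a c x u v
  proof -
    interpret hermitian_norden_space "g c x" "J 1 c x" "J 2 c x" "J 3 c x"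
      by (rule hermitian_norden_space_at[OF M c x])
    obtain \<omega> where \<omega>: "linear \<omega>" and D1: "\<And>u v. cov_endo \<Gamma> (J 1) c x u v = 0"
      and D2: "\<And>u v. cov_endo \<Gamma> (J 2) c x u v = \<omega> u *\<^sub>R J 3 c x v"
      and D3: "\<And>u v. cov_endo \<Gamma> (J 3) c x u v = - \<omega> u *\<^sub>R J 2 c x v"
      using quaternionic_kaehler_at[OF M lc QK c x] by blast
    have "\<omega> u = 0"
    proof (rule class_forces_form_zero[OF C _ \<omega>])
      show "class_cond C n (g c x) (J 2 c x) (fund J g \<Gamma> 2 c x) (lee J g \<Gamma> 2 c x)"
        using in_C c x unfolding in_class_def by blast
      show "fund J g \<Gamma> 2 c x u v w = \<omega> u * g c x (J 3 c x v) w" for u v w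
        by (simp add: fund_def D2 g_simps)
      show "lee J g \<Gamma> 2 c x z = \<omega> (J 3 c x z)" for z
        by (rule lee_form_2[OF M c x \<omega> D2 D3])
    qed (use hermitian_norden_dim[OF M] in simp)
    then show ?thesis
      using a D1 D2 D3 by auto
  qed
  then show ?thesis by (simp add: hyper_kaehler_def)
qed

lemma hyper_kaehler_flat:
  assumes M: "hermitian_norden_manifold n X A J g" and lc: "levi_civita A g \<Gamma>"
    and HK: "hyper_kaehler A J \<Gamma>"
  shows "flat A \<Gamma>"
proof -
  have "curvature \<Gamma> c x u v w = 0"
    if c: "c \<in> A" and x: "x \<in> coord_image c UNIV" for c x u v w
  proof -
    interpret hermitian_norden_space "g c x" "J 1 c x" "J 2 c x" "J 3 c x"
      by (rule hermitian_norden_space_at[OF M c x])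
    note op = hermitian_norden_open[OF M c]
    have commute: "curvature \<Gamma> c x u v (J a c x w) = J a c x (curvature \<Gamma> c x u v w)"
      if a: "a \<in> {1, 2, 3}" for a u v w
    proof (rule parallel_endo_commutes_curvature[OF levi_civita_connection[OF lc c x]
          hermitian_norden_endo_field[OF M a] c op x])
      show "cov_endo \<Gamma> (J a) c y u v = 0" if "y \<in> coord_image c UNIV" for y u v
        using HK a c that unfolding hyper_kaehler_def by blast
    qed
    show ?thesis
      by (rule pure_curvature_eq_0[OF curvature_skew first_bianchi[OF lc c op x]
            curvature_metric_skew[OF lc hermitian_norden_bilin_field[OF M] c op x]
            commute commute]) simp_all
  qed
  then show ?thesis by (simp add: flat_def)
qed

theorem theorem13p16:
  fixes n :: nat and X :: "'a topology" and A :: "('a, 'm::finite) chart set"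
    and J :: "nat \<Rightarrow> ('a, 'm) endo_field" and g :: "('a, 'm) bilin_field"
    and \<Gamma> :: "('a, 'm) conn"
  assumes "hermitian_norden_manifold n X A J g"
    and "levi_civita A g \<Gamma>"
  shows "(quaternionic_kaehler X A J \<Gamma> \<longrightarrow>
            (\<forall>C\<in>{W0, W1, W2, W12, W23, W3}. in_class C n A J g \<Gamma> \<longrightarrow>
               hyper_kaehler A J \<Gamma> \<and> flat A \<Gamma>)) \<and>
         (quaternionic_kaehler X A J \<Gamma> \<longrightarrow>
            (\<forall>C. C \<noteq> W123 \<and> in_class C n A J g \<Gamma> \<and> \<not> (hyper_kaehler A J \<Gamma> \<and> flat A \<Gamma>) \<longrightarrow>
               C = W13)) \<and>
         (in_class W13 n A J g \<Gamma> \<longrightarrow>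
            (quaternionic_kaehler X A J \<Gamma> \<longleftrightarrow>
               (\<forall>p\<in>topspace X. \<exists>W \<omega>1. openin X W \<and> p \<in> W \<and> oneform_on A W \<omega>1 \<and>
                  (\<forall>c\<in>A. \<forall>x\<in>coord_image c W. \<forall>u v.
                     cov_endo \<Gamma> (J 1) c x u v = 0 \<and>
                     cov_endo \<Gamma> (J 2) c x u v = \<omega>1 c x u *\<^sub>R J 3 c x v \<and>
                     \<omega>1 c x u = - lee J g \<Gamma> 2 c x (J 3 c x u) \<and>
                     cov_endo \<Gamma> (J 3) c x u v = - \<omega>1 c x u *\<^sub>R J 2 c x v \<and>
                     \<omega>1 c x u = lee J g \<Gamma> 3 c x (J 2 c x u)))))"
proof -
  have flat: "hyper_kaehler A J \<Gamma> \<and> flat A \<Gamma>"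
    if "quaternionic_kaehler X A J \<Gamma>" "C \<in> {W0, W1, W2, W12, W23, W3}" "in_class C n A J g \<Gamma>" for C
    using quaternionic_kaehler_class_hyper_kaehler[OF assms that] hyper_kaehler_flat[OF assms] by blast
  moreover have "C = W13"
    if QK: "quaternionic_kaehler X A J \<Gamma>" and C: "C \<noteq> W123" "in_class C n A J g \<Gamma>"
      "\<not> (hyper_kaehler A J \<Gamma> \<and> flat A \<Gamma>)" for C
    using flat[OF QK _ C(2)] C by (cases C) simp_all
  ultimately show ?thesis
    using quaternionic_kaehler_iff[OF assms] by blast
qed

end
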